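(* Each of the penalties $\mathrm{Pen}(\mathcal{T}_{\mathrm{comp}}^{\mathrm{nodist}}/\mathcal{T}_{\mathrm{comp}}^{\mathrm{dist}})$, $\mathrm{Pen}(\mathcal{T}_{\mathrm{blind}}^{\mathrm{nodist}}/\mathcal{T}_{\mathrm{blind}}^{\mathrm{dist}})$ and $\mathrm{Pen}(\mathcal{T}_{\mathrm{blind}}^{\mathrm{nodist}}/\mathcal{T}_{\mathrm{comp}}^{\mathrm{dist}})$ is $O(m)$, and for none of them is there a function $f$ with $f(m)\in o(m)$ such that the penalty is $O(f(m))$.
   Context: Treasure hunt in trees. A tree is a finite tree rooted at the starting node of a mobile agent; at each node of degree $\delta$ the incident edges carry port numbers $0,\dots,\delta-1$, assigned arbitrarily at each node. $h(T)$ is the depth of $T$. An instance is a pair $(T,d)$ with $T$ a tree and $1\le d\le h(T)$; a knowledge is a set of instances. For a tree $T^*$ and $1\le d^*\le h(T^* )$, let $P(T^* )$ be the set of trees obtained from $T^*$ by reassigning arbitrary port numbers at each node. Knowledge types (each ranging over all trees $T^*$ and admissible $d^*$): $\mathcal{T}_{\mathrm{comp}}^{\mathrm{dist}}$ consists of the sets $\{(T^*,d^* )\}$; $\mathcal{T}_{\mathrm{blind}}^{\mathrm{dist}}$ of the sets $\{(T,d^* ):T\in P(T^* )\}$; $\mathcal{T}_{\mathrm{comp}}^{\mathrm{nodist}}$ of the sets $\{(T^*,d):1\le d\le h(T^* )\}$; $\mathcal{T}_{\mathrm{blind}}^{\mathrm{nodist}}$ of the sets $\{(T,d):T\in P(T^*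 ),1\le d\le h(T^* )\}$. A deterministic algorithm given knowledge $K$ starts at the root; at each step it sees the port numbers at its current node, chooses one based on its history (initially $K$), traverses the edge and learns the entry port and degree of the new node. The cost $C_{\mathcal{A}}^K(T,d)$ is the number of edge traversals (including revisits) by $\mathcal{A}$ in $T$ until all nodes at distance exactly $d$ from the root are visited. With $B_m(K)=\{(T,d)\in K:d\le m\}$, the overhead is $\mathcal{O}_{\mathcal{A}}^K(m)=\max_{(T,d)\in B_m(K)}C_{\mathcal{A}}^K(T,d)/d$ if $B_m(K)\ne\emptyset$, else $0$. For knowledge types $\mathcal{T}_1\ll\mathcal{T}_2$ (every $K_1\in\mathcal{T}_1$ is contained in some $K_2\in\mathcal{T}_2$) and $f:\mathbb{N}\to\mathbb{N}$, $\mathrm{Pen}(\mathcal{T}_2/\mathcal{T}_1)$ is $O(f)$ if there exist a constant $c>0$ and a deterministic algorithm $\mathcal{A}_2$ such that for every deterministic algorithm $\mathcal{A}_1$, for all $K_2\in\mathcal{T}_2$ and all $m\ge1$: $\mathcal{O}_{\mathcal{A}_2}^{K_2}(m)\le c\cdot f(m)\cdot\max_{K_1\in\mathcal{T}_1,K_1\subseteq K_2}\mathcal{O}_{\mathcal{A}_1}^{K_1}(m)$. "$O(m)$" means $O(f)$ with $f(m)=m$. *)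

theory Defs
  imports "HOL-Library.Extended_Nonnegative_Real" "HOL-Library.Landau_Symbols"
begin

section \<open>Rooted trees with port numbers\<close>

text \<open>
  The list \<open>nbrs T v\<close> encodes the port numbering at \<open>v\<close>: its length is the degree of \<open>v\<close>, and
  port \<open>i\<close> of \<open>v\<close> leads to \<open>nbrs T v ! i\<close>.
\<close>

record ptree =
  nodes :: "nat set"
  root_node :: nat
  nbrs :: "nat \<Rightarrow> nat list"

definition adj :: "ptree \<Rightarrow> nat \<Rightarrow> nat \<Rightarrow> bool" where
  "adj T u v \<longleftrightarrow> v \<in> set (nbrs T u)"

definition degree :: "ptree \<Rightarrow> nat \<Rightarrow> nat" where
  "degree T v = length (nbrs T v)"

definition is_cycle :: "ptree \<Rightarrow> nat list \<Rightarrow> bool" where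
  "is_cycle T xs \<longleftrightarrow>
     3 \<le> length xs \<and> distinct xs \<and> successively (adj T) xs \<and> adj T (last xs) (hd xs)"

text \<open>
  The condition on \<open>v \<notin> nodes T\<close> makes the representation of a tree on a given node set
  unique, so that a tree has only finitely many renumberings of its ports.
\<close>

definition is_tree :: "ptree \<Rightarrow> bool" where
  "is_tree T \<longleftrightarrow>
     finite (nodes T) \<and> root_node T \<in> nodes T \<and>
     (\<forall>v. v \<notin> nodes T \<longrightarrow> nbrs T v = []) \<and>
     (\<forall>v\<in>nodes T. distinct (nbrs T v) \<and> set (nbrs T v) \<subseteq> nodes T - {v}) \<and>
     (\<forall>u v. adj T u v \<longrightarrow> adj T v u) \<and>
     (\<forall>u\<in>nodes T. \<forall>v\<in>nodes T. (adj T)\<^sup>*\<^sup>* u v) \<and>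
     (\<nexists>xs. is_cycle T xs)"

definition depth :: "ptree \<Rightarrow> nat \<Rightarrow> nat" where
  "depth T v = (LEAST n. (adj T ^^ n) (root_node T) v)"

definition height :: "ptree \<Rightarrow> nat" where
  "height T = Max (depth T ` nodes T)"

definition level :: "ptree \<Rightarrow> nat \<Rightarrow> nat set" where
  "level T d = {v \<in> nodes T. depth T v = d}"

definition port_to :: "ptree \<Rightarrow> nat \<Rightarrow> nat \<Rightarrow> nat" where
  "port_to T v u = (THE j. j < degree T v \<and> nbrs T v ! j = u)"

definition renumberings :: "ptree \<Rightarrow> ptree set" where
  "renumberings S =
     {T. is_tree T \<and> nodes T = nodes S \<and> root_node T = root_node S \<and>
         (\<forall>v. set (nbrs T v) = set (nbrs S v))}"


section \<open>Knowledge\<close>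

type_synonym knowledge = "(ptree \<times> nat) set"

definition comp_dist :: "knowledge set" where
  "comp_dist = {{(S, e)} | S e. is_tree S \<and> 1 \<le> e \<and> e \<le> height S}"

definition blind_dist :: "knowledge set" where
  "blind_dist =
     {{(T, e) | T. T \<in> renumberings S} | S e. is_tree S \<and> 1 \<le> e \<and> e \<le> height S}"

text \<open>
  In the two following definitions the existence of an admissible distance amounts to
  \<open>1 \<le> height S\<close>; it excludes the one-node tree, on which there is no instance.
\<close>

definition comp_nodist :: "knowledge set" where
  "comp_nodist =
     {{(S, d) | d. 1 \<le> d \<and> d \<le> height S} | S. is_tree S \<and> 1 \<le> height S}"

definition blind_nodist :: "knowledge set" where
  "blind_nodist =
     {{(T, d) | T d. T \<in> renumberings S \<and> 1 \<le> d \<and> d \<le> height S} | S.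
        is_tree S \<and> 1 \<le> height S}"

definition kt_below :: "knowledge set \<Rightarrow> knowledge set \<Rightarrow> bool" (infix \<open>\<lless>\<close> 50) where
  "\<T>\<^sub>1 \<lless> \<T>\<^sub>2 \<longleftrightarrow> (\<forall>K\<^sub>1\<in>\<T>\<^sub>1. \<exists>K\<^sub>2\<in>\<T>\<^sub>2. K\<^sub>1 \<subseteq> K\<^sub>2)"


section \<open>Algorithms, cost and overhead\<close>

text \<open>
  A history consists of the degree of the root and, for each move made so far in chronological
  order, the triple of the port taken, the port of entry at the new node, and the degree of the
  new node.
\<close>

type_synonym history = "nat \<times> (nat \<times> nat \<times> nat) list"

type_synonym algorithm = "knowledge \<Rightarrow> history \<Rightarrow> nat"

definition current_degree :: "history \<Rightarrow> nat" where
  "current_degree H = (if snd H = [] then fst H else snd (snd (last (snd H))))"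

definition is_algorithm :: "algorithm \<Rightarrow> bool" where
  "is_algorithm A \<longleftrightarrow> (\<forall>K H. 0 < current_degree H \<longrightarrow> A K H < current_degree H)"

fun run :: "algorithm \<Rightarrow> knowledge \<Rightarrow> ptree \<Rightarrow> nat \<Rightarrow> nat \<times> history" where
  "run A K T 0 = (root_node T, (degree T (root_node T), []))"
| "run A K T (Suc n) =
     (let (u, H) = run A K T n; p = A K H; v = nbrs T u ! p
      in (v, (fst H, snd H @ [(p, port_to T v u, degree T v)])))"

definition visited :: "algorithm \<Rightarrow> knowledge \<Rightarrow> ptree \<Rightarrow> nat \<Rightarrow> nat set" where
  "visited A K T n = (\<lambda>i. fst (run A K T i)) ` {..n}"

definition cost :: "algorithm \<Rightarrow> knowledge \<Rightarrow> ptree \<Rightarrow> nat \<Rightarrow> ennreal" where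
  "cost A K T d =
     (if \<exists>n. level T d \<subseteq> visited A K T n
      then of_nat (LEAST n. level T d \<subseteq> visited A K T n) else \<infinity>)"

definition restrict_dist :: "nat \<Rightarrow> knowledge \<Rightarrow> knowledge" where
  "restrict_dist m K = {(T, d) \<in> K. d \<le> m}"

text \<open>
  Maxima are rendered as suprema in \<^typ>\<open>ennreal\<close>: costs may be infinite, and all the knowledge
  sets above are finite.
\<close>

definition overhead :: "algorithm \<Rightarrow> knowledge \<Rightarrow> nat \<Rightarrow> ennreal" where
  "overhead A K m =
     (if restrict_dist m K = {} then 0
      else SUP (T, d) \<in> restrict_dist m K. cost A K T d / of_nat d)"


section \<open>Penalty\<close>

text \<open>\<open>pen_bigo \<T>\<^sub>2 \<T>\<^sub>1 f\<close> says that \<open>Pen(\<T>\<^sub>2/\<T>\<^sub>1)\<close> is \<open>O(f)\<close>.\<close>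

definition pen_bigo :: "knowledge set \<Rightarrow> knowledge set \<Rightarrow> (nat \<Rightarrow> nat) \<Rightarrow> bool" where
  "pen_bigo \<T>\<^sub>2 \<T>\<^sub>1 f \<longleftrightarrow>
     (\<exists>c::real. c > 0 \<and> (\<exists>A\<^sub>2. is_algorithm A\<^sub>2 \<and>
        (\<forall>A\<^sub>1. is_algorithm A\<^sub>1 \<longrightarrow>
           (\<forall>K\<^sub>2\<in>\<T>\<^sub>2. \<forall>m\<ge>1.
              overhead A\<^sub>2 K\<^sub>2 m
                \<le> ennreal c * of_nat (f m) * (SUP K\<^sub>1\<in>{K\<^sub>1\<in>\<T>\<^sub>1. K\<^sub>1 \<subseteq> K\<^sub>2}. overhead A\<^sub>1 K\<^sub>1 m)))))"


section \<open>Well-definedness\<close>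

lemma renumberings_refl: "is_tree S \<Longrightarrow> S \<in> renumberings S"
  by (simp add: renumberings_def)

lemma comp_dist_below_comp_nodist: "comp_dist \<lless> comp_nodist"
  unfolding kt_below_def
proof
  fix K assume "K \<in> comp_dist"
  then obtain S e where K: "K = {(S, e)}" and S: "is_tree S" "1 \<le> e" "e \<le> height S"
    unfolding comp_dist_def by blast
  let ?L = "{(S, d) | d. 1 \<le> d \<and> d \<le> height S}"
  have "1 \<le> height S" using S by simp
  then have "?L \<in> comp_nodist" using S(1) unfolding comp_nodist_def by blast
  moreover have "K \<subseteq> ?L" using K S by simp
  ultimately show "\<exists>L\<in>comp_nodist. K \<subseteq> L" by blast
qed

lemma blind_dist_below_blind_nodist: "blind_dist \<lless> blind_nodist"
  unfolding kt_below_def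
proof
  fix K assume "K \<in> blind_dist"
  then obtain S e where K: "K = {(T, e) | T. T \<in> renumberings S}"
    and S: "is_tree S" "1 \<le> e" "e \<le> height S"
    unfolding blind_dist_def by blast
  let ?L = "{(T, d) | T d. T \<in> renumberings S \<and> 1 \<le> d \<and> d \<le> height S}"
  have "1 \<le> height S" using S by simp
  then have "?L \<in> blind_nodist" using S(1) unfolding blind_nodist_def by blast
  moreover have "K \<subseteq> ?L" using K S by auto
  ultimately show "\<exists>L\<in>blind_nodist. K \<subseteq> L" by blast
qed

lemma comp_dist_below_blind_dist: "comp_dist \<lless> blind_dist"
  unfolding kt_below_def
proof
  fix K assume "K \<in> comp_dist"
  then obtain S e where K: "K = {(S, e)}" and S: "is_tree S" "1 \<le> e" "e \<le> height S"
    unfolding comp_dist_def by blast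
  let ?L = "{(T, e) | T. T \<in> renumberings S}"
  have "?L \<in> blind_dist" using S unfolding blind_dist_def by blast
  moreover have "K \<subseteq> ?L" using K renumberings_refl[OF S(1)] by simp
  ultimately show "\<exists>L\<in>blind_dist. K \<subseteq> L" by blast
qed

lemma comp_dist_below_blind_nodist: "comp_dist \<lless> blind_nodist"
  using comp_dist_below_blind_dist blind_dist_below_blind_nodist
  unfolding kt_below_def by (meson order_trans)

lemma finite_renumberings:
  assumes "is_tree S"
  shows "finite (renumberings S)"
proof -
  let ?V = "nodes S"
  let ?B = "{xs. set xs \<subseteq> ?V \<and> distinct xs}"
  let ?F = "{f. \<forall>v. (v \<in> ?V \<longrightarrow> f v \<in> ?B) \<and> (v \<notin> ?V \<longrightarrow> f v = [])}"
  have fin: "finite ?V" using assms by (simp add: is_tree_def)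
  have "finite ?B" using finite_subset_distinct[OF fin] by simp
  then have "finite ?F" using fin by (intro finite_set_of_finite_funs)
  moreover have "nbrs ` renumberings S \<subseteq> ?F"
  proof (rule image_subsetI)
    fix T assume "T \<in> renumberings S"
    then have T: "is_tree T" "nodes T = ?V" by (simp_all add: renumberings_def)
    have "set (nbrs T v) \<subseteq> ?V \<and> distinct (nbrs T v)" if "v \<in> ?V" for v
      using T that unfolding is_tree_def by (metis Diff_subset subset_trans)
    moreover have "nbrs T v = []" if "v \<notin> ?V" for v
      using T that by (simp add: is_tree_def)
    ultimately show "nbrs T \<in> ?F" by simp
  qed
  ultimately have "finite (nbrs ` renumberings S)" by (rule rev_finite_subset)
  moreover have "inj_on nbrs (renumberings S)"
    by (rule inj_onI) (simp add: renumberings_def)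
  ultimately show ?thesis by (rule finite_imageD)
qed

lemma finite_blind_nodist:
  assumes "K \<in> blind_nodist"
  shows "finite K"
proof -
  obtain S where S: "is_tree S"
    and K: "K = {(T, d) | T d. T \<in> renumberings S \<and> 1 \<le> d \<and> d \<le> height S}"
    using assms unfolding blind_nodist_def by blast
  have "K \<subseteq> renumberings S \<times> {..height S}" using K by auto
  then show ?thesis
    by (rule finite_subset) (simp add: finite_renumberings[OF S])
qed

end

theory Submission
  imports Defs "HOL-Library.Nat_Bijection"
begin

text \<open>
  Upper bound. Visiting level \<open>j\<close> takes at least as many moves as level \<open>j\<close> has nodes. Knowing the
  shape of the tree, but neither the ports nor the distance, the agent makes depth-first tours by
  the right-hand rule, the \<open>k\<close>-th one down to the largest depth \<open>r\<close> for which the ball of radius \<open>r\<close>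
  has at most \<open>2 ^ k\<close> times as many nodes as the ball of radius 1. As the balls double in size, all of
  level \<open>d\<close> is visited after \<open>O(b)\<close> moves, where \<open>b\<close> is the total size of the levels \<open>1, \<dots>, d\<close>. If every
  level \<open>j \<le> m\<close> has at most \<open>j * M\<close> nodes, this is \<open>O(d\<^sup>2 * M)\<close>, hence an overhead of \<open>O(m * M)\<close>.

  Lower bound. For \<open>i = 1, \<dots>, m\<close>, attach to the root a path of length \<open>i\<close> whose end carries
  \<open>m * i\<close> leaves. Whatever the ports are, an agent that knows \<open>d\<close> follows each path at most to
  depth \<open>d\<close> and visits only the leaves at depth \<open>d\<close>, with an overhead of at most \<open>4 * m\<close>. An agent
  that does not know \<open>d\<close> has to visit all of the roughly \<open>m\<^sup>3 / 2\<close> leaves of depth at most \<open>m\<close> before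
  the last of the levels \<open>1, \<dots>, m\<close> is complete, with an overhead of order \<open>m\<^sup>2\<close>.
\<close>

section \<open>Structure of rooted trees\<close>

text \<open>When a step leads back to a node already on the path, the path is cut off at that node
  instead of being extended.\<close>

lemma rtranclp_imp_distinct_path:
  assumes "R\<^sup>*\<^sup>* a b"
  shows "\<exists>xs. xs \<noteq> [] \<and> hd xs = a \<and> last xs = b \<and> distinct xs \<and> successively R xs"
  using assms
proof induction
  case base
  show ?case by (rule exI[of _ "[a]"]) simp
next
  case (step y z)
  then obtain xs where xs: "xs \<noteq> []" "hd xs = a" "last xs = y" "distinct xs" "successively R xs"
    by blast
  show ?case
  proof (cases "z \<in> set xs")
    case True
    then obtain us vs where "xs = us @ z # vs" by (meson split_list)
    then have "us @ [z] \<noteq> []" "hd (us @ [z]) = a" "last (us @ [z]) = z" "distinct (us @ [z])"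
      "successively R (us @ [z])"
      using xs by (auto simp: hd_append successively_append_iff split: if_splits)
    then show ?thesis by blast
  next
    case False
    then have "hd (xs @ [z]) = a" "distinct (xs @ [z])" "successively R (xs @ [z])"
      using xs step.hyps(2) by (auto simp: successively_append_iff)
    then show ?thesis by (intro exI[of _ "xs @ [z]"]) auto
  qed
qed

text \<open>At the root no node qualifies and the value is arbitrary, so facts about parents exclude
  the root.\<close>

definition parent :: "ptree \<Rightarrow> nat \<Rightarrow> nat" where
  "parent T v = (THE u. adj T v u \<and> depth T u < depth T v)"

locale rooted_tree =
  fixes T :: ptree
  assumes tree: "is_tree T"
begin

lemma finite_nodes: "finite (nodes T)"
  and root_in_nodes: "root_node T \<in> nodes T"
  and adj_sym: "adj T u v \<Longrightarrow> adj T v u"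
  and connected: "u \<in> nodes T \<Longrightarrow> v \<in> nodes T \<Longrightarrow> (adj T)\<^sup>*\<^sup>* u v"
  and acyclic: "\<not> is_cycle T xs"
  using tree unfolding is_tree_def by blast+

lemma adj_nodes: "adj T u v \<Longrightarrow> u \<in> nodes T"
  using tree unfolding is_tree_def adj_def by (metis empty_iff empty_set)

lemma adj_nodes': "adj T u v \<Longrightarrow> v \<in> nodes T"
  using adj_nodes adj_sym by blast

lemma adj_irrefl: "\<not> adj T v v"
  using tree adj_nodes[of v v] unfolding is_tree_def adj_def by blast

lemma distinct_nbrs: "distinct (nbrs T v)"
  using tree unfolding is_tree_def by (metis distinct.simps(1))

lemma port_to_eqI: "i < degree T v \<Longrightarrow> nbrs T v ! i = u \<Longrightarrow> port_to T v u = i"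
  unfolding port_to_def degree_def
  by (rule the_equality) (auto simp: distinct_nbrs nth_eq_iff_index_eq)

lemma port_to:
  assumes "adj T v u"
  shows "port_to T v u < degree T v" "nbrs T v ! port_to T v u = u"
proof -
  obtain i where "i < degree T v" "nbrs T v ! i = u"
    using assms unfolding adj_def degree_def in_set_conv_nth by blast
  then show "port_to T v u < degree T v" "nbrs T v ! port_to T v u = u"
    using port_to_eqI by auto
qed

lemma adj_nth: "i < degree T v \<Longrightarrow> adj T v (nbrs T v ! i)"
  by (simp add: adj_def degree_def)

lemma depth_le: "(adj T ^^ n) (root_node T) v \<Longrightarrow> depth T v \<le> n"
  unfolding depth_def by (rule Least_le)

lemma depth_walk:
  assumes "v \<in> nodes T"
  shows "(adj T ^^ depth T v) (root_node T) v"
  unfolding depth_def using connected[OF root_in_nodes assms] rtranclp_imp_relpowp LeastI_ex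
  by (metis (mono_tags, lifting))

lemma depth_root [simp]: "depth T (root_node T) = 0"
  using depth_le[of 0 "root_node T"] by simp

lemma depth_eq_0: "v \<in> nodes T \<Longrightarrow> depth T v = 0 \<Longrightarrow> v = root_node T"
  using depth_walk by fastforce

lemma depth_adj_le: "adj T u v \<Longrightarrow> depth T v \<le> Suc (depth T u)"
  using depth_walk[OF adj_nodes] by (intro depth_le) auto

text \<open>The last but one node of a shortest walk from the root to \<open>v\<close> has the
  required depth.\<close>

lemma closer_neighbour_exists:
  assumes "v \<in> nodes T" "v \<noteq> root_node T"
  shows "\<exists>u. adj T v u \<and> Suc (depth T u) = depth T v"
proof -
  obtain n where n: "depth T v = Suc n"
    using depth_eq_0 assms not0_implies_Suc by blast
  then obtain u where u: "(adj T ^^ n) (root_node T) u" "adj T u v"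
    using depth_walk[OF assms(1)] by auto
  then have "Suc (depth T u) = depth T v"
    using depth_le[OF u(1)] depth_adj_le[OF u(2)] n by simp
  then show ?thesis using u(2) adj_sym by blast
qed

text \<open>Two distinct neighbours of \<open>v\<close> that are not deeper than \<open>v\<close> are joined through the root by
  a path avoiding \<open>v\<close>, which closes to a cycle.\<close>

lemma closer_neighbour_unique:
  assumes "adj T v a" "adj T v b" "depth T a \<le> depth T v" "depth T b \<le> depth T v"
  shows "a = b"
proof (rule ccontr)
  assume ne: "a \<noteq> b"
  define Q where "Q = (\<lambda>x y. adj T x y \<and> x \<noteq> v \<and> y \<noteq> v)"
  have symQ: "symp Q" unfolding Q_def using adj_sym by (auto intro: sympI)
  have to_root: "Q\<^sup>*\<^sup>* x (root_node T)"
    if "x \<in> nodes T" "x \<noteq> v" "depth T x \<le> depth T v" for x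
    using that
  proof (induction "depth T x" arbitrary: x rule: less_induct)
    case less
    show ?case
    proof (cases "x = root_node T")
      case False
      then obtain u where u: "adj T x u" "Suc (depth T u) = depth T x"
        using closer_neighbour_exists less.prems by blast
      \<comment> \<open>The node \<open>u\<close> is strictly closer to the root than
        \<open>x\<close>, and \<open>x\<close> is at most as deep as \<open>v\<close>.\<close>
      have "u \<noteq> v" using u less.prems by auto
      then have "Q x u" using u less.prems Q_def by simp
      moreover have "Q\<^sup>*\<^sup>* u (root_node T)"
        using less.hyps[of u] u \<open>u \<noteq> v\<close> less.prems adj_nodes' by simp
      ultimately show ?thesis by (rule converse_rtranclp_into_rtranclp)
    qed simp
  qed
  have v: "a \<noteq> v" "b \<noteq> v" using assms adj_irrefl by auto
  have "Q\<^sup>*\<^sup>* a (root_node T)" "Q\<^sup>*\<^sup>* b (root_node T)"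
    using to_root v assms adj_nodes' by blast+
  then have "Q\<^sup>*\<^sup>* a b"
    using symQ by (meson rtranclp_trans sympD symp_rtranclp)
  then obtain xs where xs: "xs \<noteq> []" "hd xs = a" "last xs = b" "distinct xs" "successively Q xs"
    using rtranclp_imp_distinct_path by metis
  \<comment> \<open>The ends differ, so \<open>xs\<close> has at least two nodes and
    \<open>v # xs\<close> the three that a cycle needs.\<close>
  have len: "2 \<le> length xs"
    using xs ne by (cases xs rule: remdups_adj.cases) auto
  have "v \<notin> set xs"
  proof
    assume "v \<in> set xs"
    then obtain i where i: "i < length xs" "xs ! i = v" by (auto simp: in_set_conv_nth)
    have "Q (xs ! (i - 1)) (xs ! i)" if "0 < i"
      using xs(5) i that unfolding successively_conv_nth by (metis Suc_pred')
    moreover have "i \<noteq> 0" using i xs v by (metis hd_conv_nth)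
    ultimately show False using i Q_def by simp
  qed
  moreover have "successively (adj T) xs"
    using xs(5) by (rule successively_mono) (simp add: Q_def)
  ultimately have "is_cycle T (v # xs)"
    unfolding is_cycle_def using xs len assms adj_sym by (auto simp: successively_Cons)
  then show False using acyclic by blast
qed

lemma parent_eqI: "adj T v u \<Longrightarrow> depth T u < depth T v \<Longrightarrow> parent T v = u"
  unfolding parent_def
  by (rule the_equality) (auto intro: closer_neighbour_unique)

lemma parent:
  assumes "v \<in> nodes T" "v \<noteq> root_node T"
  shows "adj T v (parent T v)" "Suc (depth T (parent T v)) = depth T v"
proof -
  obtain u where u: "adj T v u" "Suc (depth T u) = depth T v"
    using closer_neighbour_exists[OF assms] by blast
  then have "parent T v = u" by (intro parent_eqI) auto
  then show "adj T v (parent T v)" "Suc (depth T (parent T v)) = depth T v" using u by auto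
qed

text \<open>Uniqueness of the closer neighbour also covers neighbours of equal depth, so a neighbour
  other than the parent can only be deeper.\<close>

lemma child:
  assumes "adj T v c" "v = root_node T \<or> c \<noteq> parent T v"
  shows "c \<noteq> root_node T" "parent T c = v" "depth T c = Suc (depth T v)"
proof -
  have "depth T v < depth T c"
  proof (rule ccontr)
    assume le: "\<not> depth T v < depth T c"
    show False
    proof (cases "v = root_node T")
      case True
      then have "c = root_node T" using le depth_eq_0 adj_nodes'[OF assms(1)] by simp
      then show False using True assms(1) adj_irrefl by simp
    next
      case False
      then have "c = parent T v"
        using closer_neighbour_unique[OF assms(1) parent(1)[OF adj_nodes[OF assms(1)] False]]
          parent(2)[OF adj_nodes[OF assms(1)] False] le by simp
      then show False using False assms(2) by simp
    qed
  qed
  then show "c \<noteq> root_node T" "parent T c = v" "depth T c = Suc (depth T v)"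
    using parent_eqI[OF adj_sym[OF assms(1)]] depth_adj_le[OF assms(1)] by auto
qed

end

section \<open>Tours by the right-hand rule\<close>

text \<open>The agent is at \<open>v\<close>, which it entered through port \<open>q\<close>. It turns back if \<open>tb\<close> holds for the
  depth and the degree of \<open>v\<close>, and otherwise leaves through the cyclically next port.\<close>

definition next_dart :: "ptree \<Rightarrow> (nat \<Rightarrow> nat \<Rightarrow> bool) \<Rightarrow> nat \<times> nat \<Rightarrow> nat \<times> nat" where
  "next_dart T tb = (\<lambda>(v, q).
     let p = (if tb (depth T v) (degree T v) then q else (q + 1) mod degree T v);
         w = nbrs T v ! p
     in (w, port_to T w v))"

definition explore_step :: "ptree \<Rightarrow> (nat \<Rightarrow> nat \<Rightarrow> bool) \<Rightarrow> nat \<Rightarrow> nat \<Rightarrow> bool" where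
  "explore_step T tb v w \<longleftrightarrow>
     adj T v w \<and> depth T w = Suc (depth T v) \<and> \<not> tb (depth T v) (degree T v)"

definition explored :: "ptree \<Rightarrow> (nat \<Rightarrow> nat \<Rightarrow> bool) \<Rightarrow> nat \<Rightarrow> nat set" where
  "explored T tb v = {w. (explore_step T tb)\<^sup>*\<^sup>* v w}"

text \<open>The end dart and the number of moves are exact, while \<open>W\<close> is only a lower
  bound on the visited nodes: tours are glued at their end darts and the sets accumulate.\<close>

definition tour_reaches ::
  "ptree \<Rightarrow> (nat \<Rightarrow> nat \<Rightarrow> bool) \<Rightarrow> nat \<times> nat \<Rightarrow> nat \<Rightarrow> nat \<times> nat \<Rightarrow> nat set \<Rightarrow> bool" where
  "tour_reaches T tb x n y W \<longleftrightarrow>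
     (next_dart T tb ^^ n) x = y \<and> W \<subseteq> (\<lambda>i. fst ((next_dart T tb ^^ i) x)) ` {..n}"

lemma tour_reaches_trans:
  assumes "tour_reaches T tb x n y W" "tour_reaches T tb y k z X"
  shows "tour_reaches T tb x (n + k) z (W \<union> X)"
proof -
  let ?f = "next_dart T tb"
  have y: "(?f ^^ n) x = y" and z: "(?f ^^ k) y = z"
    and W: "W \<subseteq> (\<lambda>i. fst ((?f ^^ i) x)) ` {..n}" and X: "X \<subseteq> (\<lambda>i. fst ((?f ^^ i) y)) ` {..k}"
    using assms by (auto simp: tour_reaches_def)
  have shift: "(?f ^^ (n + i)) x = (?f ^^ i) y" for i
    using y by (simp add: add.commute[of n] funpow_add)
  have "W \<subseteq> (\<lambda>i. fst ((?f ^^ i) x)) ` {..n + k}"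
    by (rule order_trans[OF W]) (rule image_mono, simp)
  moreover have "X \<subseteq> (\<lambda>i. fst ((?f ^^ i) x)) ` {..n + k}"
  proof
    fix w assume "w \<in> X"
    then obtain i where i: "i \<le> k" "w = fst ((?f ^^ i) y)" using X by auto
    then have "w = fst ((?f ^^ (n + i)) x)" using shift by simp
    then show "w \<in> (\<lambda>i. fst ((?f ^^ i) x)) ` {..n + k}" using i(1) by (intro image_eqI) auto
  qed
  ultimately show ?thesis using shift[of k] z by (simp add: tour_reaches_def)
qed

lemma tour_reaches_step: "tour_reaches T tb x 1 (next_dart T tb x) {fst x}"
  unfolding tour_reaches_def by (auto intro!: image_eqI[of _ _ 0])

lemma self_in_explored: "v \<in> explored T tb v"
  by (simp add: explored_def)

lemma explored_unfold:
  "explored T tb v = insert v (\<Union>c\<in>{c. explore_step T tb v c}. explored T tb c)"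
  unfolding explored_def by (auto elim: converse_rtranclpE intro: converse_rtranclp_into_rtranclp)

context rooted_tree
begin

lemma explored_subset_nodes: "v \<in> nodes T \<Longrightarrow> explored T tb v \<subseteq> nodes T"
proof
  fix w assume "v \<in> nodes T" "w \<in> explored T tb v"
  then have "(explore_step T tb)\<^sup>*\<^sup>* v w" by (simp add: explored_def)
  then show "w \<in> nodes T"
    by cases (use \<open>v \<in> nodes T\<close> adj_nodes' in \<open>auto simp: explore_step_def\<close>)
qed

lemma finite_explored: "v \<in> nodes T \<Longrightarrow> finite (explored T tb v)"
  using explored_subset_nodes finite_nodes finite_subset by blast

lemma explored_depth: "w \<in> explored T tb v \<Longrightarrow> w = v \<or> depth T v < depth T w"
proof -
  assume "w \<in> explored T tb v"
  then have "(explore_step T tb)\<^sup>*\<^sup>* v w" by (simp add: explored_def)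
  then show ?thesis by induction (auto simp: explore_step_def)
qed

text \<open>This separates the sets explored below two siblings: a common node would have both as
  its ancestor at the same depth.\<close>

lemma explored_ancestor:
  assumes "w \<in> explored T tb v"
  shows "depth T v \<le> depth T w \<and> (parent T ^^ (depth T w - depth T v)) w = v"
proof -
  have "(explore_step T tb)\<^sup>*\<^sup>* v w" using assms by (simp add: explored_def)
  then show ?thesis
  proof induction
    case (step y z)
    have z: "depth T z = Suc (depth T y)" "adj T z y"
      using step.hyps(2) adj_sym by (auto simp: explore_step_def)
    then have "parent T z = y" by (intro parent_eqI) auto
    then show ?case using step.IH z by (simp add: Suc_diff_le funpow_swap1)
  qed simp
qed

lemma explored_siblings_disjoint:
  assumes "depth T c = depth T c'" "c \<noteq> c'"
  shows "explored T tb c \<inter> explored T tb c' = {}"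
  using explored_ancestor[of _ tb c] explored_ancestor[of _ tb c'] assms by auto

lemma card_explored:
  assumes "v \<in> nodes T"
  shows "card (explored T tb v) = Suc (\<Sum>c | explore_step T tb v c. card (explored T tb c))"
proof -
  let ?C = "{c. explore_step T tb v c}"
  have C: "c \<in> nodes T" "depth T c = Suc (depth T v)" if "c \<in> ?C" for c
    using that adj_nodes' by (auto simp: explore_step_def)
  have fin: "finite ?C" using finite_subset[OF _ finite_nodes, of ?C] C by blast
  have "v \<notin> (\<Union>c\<in>?C. explored T tb c)"
    using C explored_depth by fastforce
  moreover have "card (\<Union>c\<in>?C. explored T tb c) = (\<Sum>c\<in>?C. card (explored T tb c))"
    by (rule card_UN_disjoint)
      (use fin C finite_explored explored_siblings_disjoint in \<open>auto\<close>)
  ultimately show ?thesis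
    using fin C finite_explored by (subst explored_unfold) simp
qed

text \<open>Sweep over \<open>n\<close> consecutive ports of \<open>v\<close>, all of which lead to children.\<close>

lemma tour_sweep:
  assumes nt: "\<not> tb (depth T v) (degree T v)"
    and kids: "\<And>j. 1 \<le> j \<Longrightarrow> j \<le> n \<Longrightarrow> (let c = nbrs T v ! ((q + j) mod degree T v) in
         tour_reaches T tb (c, port_to T c v) (2 * card (explored T tb c) - 1)
           (v, port_to T v c) (explored T tb c) \<and> 0 < card (explored T tb c))"
    and q: "q < degree T v"
  shows "tour_reaches T tb (v, q)
     (\<Sum>j=1..n. 2 * card (explored T tb (nbrs T v ! ((q + j) mod degree T v))))
     (v, (q + n) mod degree T v)
     (insert v (\<Union>j\<in>{1..n}. explored T tb (nbrs T v ! ((q + j) mod degree T v))))"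
  using kids
proof (induction n)
  case 0
  show ?case using q by (simp add: tour_reaches_def)
next
  case (Suc n)
  let ?p = "(q + Suc n) mod degree T v"
  let ?c = "nbrs T v ! ?p"
  have p: "?p < degree T v" using q by simp
  have c: "tour_reaches T tb (?c, port_to T ?c v) (2 * card (explored T tb ?c) - 1)
           (v, port_to T v ?c) (explored T tb ?c)" "0 < card (explored T tb ?c)"
    using Suc.prems[of "Suc n"] by (auto simp: Let_def)
  have "next_dart T tb (v, (q + n) mod degree T v) = (?c, port_to T ?c v)"
    using nt by (simp add: next_dart_def Let_def mod_Suc_eq)
  then have 1: "tour_reaches T tb (v, (q + n) mod degree T v) 1 (?c, port_to T ?c v) {v}"
    using tour_reaches_step[of T tb "(v, (q + n) mod degree T v)"] by simp
  \<comment> \<open>Back at \<open>v\<close>, the entry port is the one just used, so the rule goes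
    on with the next child.\<close>
  have 2: "port_to T v ?c = ?p" using port_to_eqI p by simp
  have IH: "tour_reaches T tb (v, q)
     (\<Sum>j=1..n. 2 * card (explored T tb (nbrs T v ! ((q + j) mod degree T v))))
     (v, (q + n) mod degree T v)
     (insert v (\<Union>j\<in>{1..n}. explored T tb (nbrs T v ! ((q + j) mod degree T v))))"
    using Suc.prems by (intro Suc.IH) auto
  \<comment> \<open>One move down to the child, then its tour, whose last move leads back up to
    \<open>v\<close>.\<close>
  have len: "1 + (2 * card (explored T tb ?c) - 1) = 2 * card (explored T tb ?c)"
    using c(2) by simp
  have "{1..Suc n} = insert (Suc n) {1..n}" by auto
  then show ?case
    using tour_reaches_trans[OF IH tour_reaches_trans[OF 1 c(1)]]
    unfolding 2 len by (simp add: Un_ac add.commute)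
qed

lemma explored_turn: "tb (depth T v) (degree T v) \<Longrightarrow> explored T tb v = {v}"
  by (subst explored_unfold) (auto simp: explore_step_def)

text \<open>A full turn starting after port \<open>q\<close> meets every neighbour once, and the one
  behind \<open>q\<close> last. At a node entered from its parent, all children thus come before the
  return.\<close>

lemma bij_betw_ports:
  assumes "q < degree T v"
  shows "bij_betw (\<lambda>j. nbrs T v ! ((q + j) mod degree T v)) {1..degree T v} (set (nbrs T v))"
proof -
  let ?\<delta> = "degree T v"
  have "bij_betw (\<lambda>j. (q + j) mod ?\<delta>) {1..?\<delta>} {..<?\<delta>}"
  \<comment> \<open>As \<open>j\<close> starts from 1, port \<open>q\<close> itself is reached only
    at the end of the turn; hence \<open>i = q\<close> belongs to the wrapped case.\<close>
  proof (rule bij_betw_byWitness[where f' = "\<lambda>i. if i \<le> q then i + ?\<delta> - q else i - q"])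
    show "\<forall>j\<in>{1..?\<delta>}. (if (q + j) mod ?\<delta> \<le> q then (q + j) mod ?\<delta> + ?\<delta> - q
        else (q + j) mod ?\<delta> - q) = j"
    proof
      fix j assume j: "j \<in> {1..?\<delta>}"
      show "(if (q + j) mod ?\<delta> \<le> q then (q + j) mod ?\<delta> + ?\<delta> - q else (q + j) mod ?\<delta> - q) = j"
        using j assms by (cases "q + j < ?\<delta>") (auto simp: le_mod_geq not_less)
    qed
    show "\<forall>i\<in>{..<?\<delta>}. (q + (if i \<le> q then i + ?\<delta> - q else i - q)) mod ?\<delta> = i"
      using assms by auto
  qed (use assms in \<open>auto\<close>)
  moreover have "bij_betw (\<lambda>i. nbrs T v ! i) {..<?\<delta>} (set (nbrs T v))"
    using bij_betw_nth[OF distinct_nbrs] by (simp add: degree_def)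
  ultimately show ?thesis by (auto dest: bij_betw_trans simp: comp_def)
qed

text \<open>Each edge inside the explored part below \<open>v\<close> is traversed twice, and the
  edge to the parent once, on the final move up: with \<open>s\<close> explored nodes this is
  \<open>2 * (s - 1) + 1\<close> moves.\<close>

lemma tour_subtree:
  assumes "v \<in> nodes T" "v \<noteq> root_node T"
  shows "tour_reaches T tb (v, port_to T v (parent T v)) (2 * card (explored T tb v) - 1)
     (parent T v, port_to T (parent T v) v) (explored T tb v)"
  using assms
proof (induction "card (explored T tb v)" arbitrary: v rule: less_induct)
  case (less v)
  let ?\<delta> = "degree T v" and ?q = "port_to T v (parent T v)"
  have q: "?q < ?\<delta>" "nbrs T v ! ?q = parent T v"
    using port_to parent[OF less.prems] by auto
  show ?case
  proof (cases "tb (depth T v) ?\<delta>")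
    case True
    then show ?thesis
      using tour_reaches_step[of T tb "(v, ?q)"] q
      by (simp add: explored_turn next_dart_def Let_def)
  next
    case nt: False
    let ?c = "\<lambda>j. nbrs T v ! ((?q + j) mod ?\<delta>)"
    let ?n = "?\<delta> - 1"
    have bij: "bij_betw ?c {1..?\<delta>} (set (nbrs T v))" using bij_betw_ports q(1) by blast
    have last: "?c ?\<delta> = parent T v" using q by simp
    have rest: "{1..?n} = {1..?\<delta>} - {?\<delta>}" using q(1) by auto
    have inj: "inj_on ?c {1..?n}"
      using bij unfolding rest bij_betw_def by (blast intro: inj_on_diff)
    have "{1..?\<delta>} - {?\<delta>} \<subseteq> {1..?\<delta>}" "{?\<delta>} \<subseteq> {1..?\<delta>}" using q(1) by auto
    then have "?c ` {1..?n} = ?c ` {1..?\<delta>} - ?c ` {?\<delta>}"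
      using bij unfolding rest bij_betw_def by (intro inj_on_image_set_diff) auto
    then have img: "?c ` {1..?n} = set (nbrs T v) - {parent T v}"
      using bij last unfolding bij_betw_def by auto
    have kids: "{c. explore_step T tb v c} = ?c ` {1..?n}"
    proof -
      have "explore_step T tb v c \<longleftrightarrow> c \<in> set (nbrs T v) - {parent T v}" for c
        using child[of v c] parent[OF less.prems] nt by (auto simp: explore_step_def adj_def)
      then show ?thesis using img by auto
    qed
    have card: "card (explored T tb v) = Suc (\<Sum>j=1..?n. card (explored T tb (?c j)))"
      unfolding card_explored[OF less.prems(1), of tb] kids sum.reindex[OF inj] comp_def ..
    have sub: "explored T tb v = insert v (\<Union>j\<in>{1..?n}. explored T tb (?c j))"
      using explored_unfold[of T tb v] unfolding kids by simp
    have sweep: "tour_reaches T tb (v, ?q) (\<Sum>j=1..?n. 2 * card (explored T tb (?c j)))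
       (v, (?q + ?n) mod ?\<delta>) (explored T tb v)"
      unfolding sub
    proof (rule tour_sweep)
      show "\<not> tb (depth T v) ?\<delta>" "?q < ?\<delta>" using nt q by auto
      fix j assume j: "1 \<le> j" "j \<le> ?n"
      have "?c j \<in> ?c ` {1..?n}" using j by (intro imageI) simp
      then have "?c j \<in> set (nbrs T v) - {parent T v}" unfolding img .
      then have c: "?c j \<in> nodes T" "?c j \<noteq> root_node T" "parent T (?c j) = v"
        using child[of v "?c j"] adj_nodes' by (auto simp: adj_def)
      have pos: "0 < card (explored T tb (?c j))"
        using finite_explored[OF c(1)] self_in_explored card_gt_0_iff by blast
      have "card (explored T tb (?c j)) \<le> (\<Sum>j=1..?n. card (explored T tb (?c j)))"
        using j by (intro member_le_sum) auto
      then have "card (explored T tb (?c j)) < card (explored T tb v)" using card by simp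
      then show "(let c = ?c j in
         tour_reaches T tb (c, port_to T c v) (2 * card (explored T tb c) - 1)
           (v, port_to T v c) (explored T tb c) \<and> 0 < card (explored T tb c))"
        using less.hyps[of "?c j"] c pos q(1) by (simp add: Let_def)
    qed
    \<comment> \<open>After the sweep the cyclically next port is the entry port, so the next move
      goes up.\<close>
    have "next_dart T tb (v, (?q + ?n) mod ?\<delta>)
        = (parent T v, port_to T (parent T v) v)"
    proof -
      have "Suc ((?q + ?n) mod ?\<delta>) mod ?\<delta> = ?q" using q(1) by (simp add: mod_Suc_eq)
      then show ?thesis using nt q by (simp add: next_dart_def Let_def)
    qed
    then have "tour_reaches T tb (v, (?q + ?n) mod ?\<delta>) 1
        (parent T v, port_to T (parent T v) v) {v}"
      using tour_reaches_step[of T tb "(v, (?q + ?n) mod ?\<delta>)"] by simp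
    note tour_reaches_trans[OF sweep this]
    moreover have "(\<Sum>j=1..?n. 2 * card (explored T tb (?c j))) + 1 = 2 * card (explored T tb v) - 1"
      using card by (simp add: sum_distrib_left)
    ultimately show ?thesis using self_in_explored by (simp add: insert_absorb)
  qed
qed

text \<open>The root has no parent, so all its ports are swept. Pretending to have entered through
  the last port makes the tour end in the dart in which it began, ready for another tour.\<close>

lemma tour_root:
  assumes "0 < degree T (root_node T)" "\<not> tb 0 (degree T (root_node T))"
  shows "tour_reaches T tb (root_node T, degree T (root_node T) - 1)
     (2 * card (explored T tb (root_node T) - {root_node T}))
     (root_node T, degree T (root_node T) - 1) (explored T tb (root_node T))"
proof -
  let ?v = "root_node T"
  let ?\<delta> = "degree T ?v"
  let ?q = "?\<delta> - 1"
  let ?c = "\<lambda>j. nbrs T ?v ! ((?q + j) mod ?\<delta>)"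
  have q: "?q < ?\<delta>" using assms(1) by simp
  have img: "?c ` {1..?\<delta>} = set (nbrs T ?v)" and inj: "inj_on ?c {1..?\<delta>}"
    using bij_betw_ports[OF q] by (auto simp: bij_betw_def)
  have kids: "{c. explore_step T tb ?v c} = ?c ` {1..?\<delta>}"
    using child[of ?v] assms(2) unfolding img by (auto simp: explore_step_def adj_def)
  have card: "card (explored T tb ?v) = Suc (\<Sum>j=1..?\<delta>. card (explored T tb (?c j)))"
    unfolding card_explored[OF root_in_nodes, of tb] kids sum.reindex[OF inj] comp_def ..
  have sub: "explored T tb ?v = insert ?v (\<Union>j\<in>{1..?\<delta>}. explored T tb (?c j))"
    using explored_unfold[of T tb ?v] unfolding kids by simp
  have "tour_reaches T tb (?v, ?q) (\<Sum>j=1..?\<delta>. 2 * card (explored T tb (?c j)))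
     (?v, (?q + ?\<delta>) mod ?\<delta>) (explored T tb ?v)"
    unfolding sub
  proof (rule tour_sweep)
    show "\<not> tb (depth T ?v) ?\<delta>" "?q < ?\<delta>" using assms(2) q by auto
    fix j assume j: "1 \<le> j" "j \<le> ?\<delta>"
    have "?c j \<in> set (nbrs T ?v)" using img j by auto
    then have c: "?c j \<in> nodes T" "?c j \<noteq> root_node T" "parent T (?c j) = ?v"
      using child[of ?v "?c j"] adj_nodes' by (auto simp: adj_def)
    have "0 < card (explored T tb (?c j))"
      using finite_explored[OF c(1)] self_in_explored card_gt_0_iff by blast
    then show "(let c = ?c j in
       tour_reaches T tb (c, port_to T c ?v) (2 * card (explored T tb c) - 1)
         (?v, port_to T ?v c) (explored T tb c) \<and> 0 < card (explored T tb c))"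
      using tour_subtree[OF c(1,2), of tb] c assms(1) by (simp add: Let_def)
  qed
  moreover have "card (explored T tb ?v - {?v}) = (\<Sum>j=1..?\<delta>. card (explored T tb (?c j)))"
    using card self_in_explored[of ?v T tb] by (simp add: card_Diff_singleton)
  moreover have "(?q + ?\<delta>) mod ?\<delta> = ?q" unfolding mod_add_self2 using q by (rule mod_less)
  ultimately show ?thesis by (simp only: sum_distrib_left)
qed

text \<open>Here \<open>P\<close> is an invariant of the climb from \<open>w\<close> to the root. It
  carries what must be known about \<open>w\<close> to see that the tour does not turn back at any
  proper ancestor.\<close>

lemma explored_rootI:
  assumes "w \<in> nodes T" "P w"
    and "\<And>w. w \<in> nodes T \<Longrightarrow> w \<noteq> root_node T \<Longrightarrow> P w \<Longrightarrow>
       P (parent T w) \<and> \<not> tb (depth T (parent T w)) (degree T (parent T w))"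
  shows "w \<in> explored T tb (root_node T)"
  using assms(1,2)
proof (induction "depth T w" arbitrary: w rule: less_induct)
  case less
  show ?case
  proof (cases "w = root_node T")
    case True
    then show ?thesis by (simp add: self_in_explored)
  next
    case False
    note p = parent[OF less.prems(1) False]
    note P = assms(3)[OF less.prems(1) False less.prems(2)]
    have "parent T w \<in> explored T tb (root_node T)"
      using less.hyps p P adj_nodes' by (metis lessI)
    moreover have "explore_step T tb (parent T w) w"
      using p P adj_sym by (simp add: explore_step_def)
    ultimately show ?thesis unfolding explored_def by auto
  qed
qed

end

text \<open>The ports leading to the parent, along the path from the current node to the root; its length
  is the current depth. A move through the port on top of the stack goes up.\<close>

definition parent_ports :: "(nat \<times> nat \<times> nat) list \<Rightarrow> nat list" where
  "parent_ports = foldl (\<lambda>s (p, q, _). if s \<noteq> [] \<and> p = hd s then tl s else q # s) []"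

text \<open>At the start the agent behaves as if it had entered the root through its last port.\<close>

definition entry_port :: "history \<Rightarrow> nat" where
  "entry_port H = (if snd H = [] then fst H - 1 else fst (snd (last (snd H))))"

text \<open>The rule \<open>tb\<close> receives only what the agent can compute: its knowledge, the
  number of moves made, the depth as the height of the port stack, and the degree. The outer
  \<open>mod\<close> yields a legal port even for histories that never occur.\<close>

definition tour :: "(knowledge \<Rightarrow> nat \<Rightarrow> nat \<Rightarrow> nat \<Rightarrow> bool) \<Rightarrow> algorithm" where
  "tour tb K H =
     (if tb K (length (snd H)) (length (parent_ports (snd H))) (current_degree H)
      then entry_port H else entry_port H + 1) mod current_degree H"

lemma is_algorithm_tour: "is_algorithm (tour tb)"
  by (simp add: is_algorithm_def tour_def)

section \<open>Runs of a tour as walks on darts\<close>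

context rooted_tree
begin

text \<open>The content that the stack should have at \<open>v\<close> when \<open>n\<close> is the
  depth of \<open>v\<close>. Recursion on \<open>n\<close> avoids a termination argument along
  \<open>parent\<close>.\<close>

primrec root_path_ports :: "nat \<Rightarrow> nat \<Rightarrow> nat list" where
  "root_path_ports 0 v = []"
| "root_path_ports (Suc n) v = port_to T v (parent T v) # root_path_ports n (parent T v)"

lemma length_root_path_ports [simp]: "length (root_path_ports n v) = n"
  by (induction n arbitrary: v) auto

text \<open>A move goes up exactly if its port leads to the parent, and that port is on top of the
  stack. So the history determines the stack, and with it the depth.\<close>

lemma run_tour:
  assumes "0 < degree T (root_node T)" "run (tour tb) K T n = (u, H)"
  shows "u \<in> nodes T \<and> length (snd H) = n \<and> current_degree H = degree T u \<and>
    entry_port H < degree T u \<and> parent_ports (snd H) = root_path_ports (depth T u) u"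
  using assms(2)
proof (induction n arbitrary: u H)
  case 0
  then show ?case
    using assms(1) root_in_nodes
    by (auto simp: current_degree_def entry_port_def parent_ports_def)
next
  case (Suc n)
  obtain v G where run: "run (tour tb) K T n = (v, G)" by (cases "run (tour tb) K T n")
  note IH = Suc.IH[OF run]
  let ?p = "tour tb K G"
  have p: "?p < degree T v"
    using IH by (simp add: tour_def)
  have u: "u = nbrs T v ! ?p" and H: "H = (fst G, snd G @ [(?p, port_to T u v, degree T u)])"
    using Suc.prems run by (auto simp: Let_def)
  have adj: "adj T v u" using adj_nth[OF p] u by simp
  have parent_ports: "parent_ports (snd H) =
     (if parent_ports (snd G) \<noteq> [] \<and> ?p = hd (parent_ports (snd G))
      then tl (parent_ports (snd G)) else port_to T u v # parent_ports (snd G))"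
    using H by (simp add: parent_ports_def)
  have port: "port_to T v u = ?p" using port_to_eqI p u by simp
  have "parent_ports (snd H) = root_path_ports (depth T u) u"
  proof (cases "v \<noteq> root_node T \<and> u = parent T v")
    case True
    then have "depth T v = Suc (depth T u)" using parent[of v] IH by simp
    then show ?thesis using IH parent_ports True port by auto
  next
    case False
    then have c: "parent T u = v" "depth T u = Suc (depth T v)"
      using child[OF adj] by auto
    have down: "\<not> (parent_ports (snd G) \<noteq> [] \<and> ?p = hd (parent_ports (snd G)))"
    proof
      assume asm: "parent_ports (snd G) \<noteq> [] \<and> ?p = hd (parent_ports (snd G))"
      then obtain k where k: "depth T v = Suc k" using IH by (cases "depth T v") auto
      then have v: "v \<noteq> root_node T" by auto
      have "?p = port_to T v (parent T v)" using asm IH k by simp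
      then have "u = parent T v" using u port_to(2) parent(1) IH v by simp
      then show False using False v by simp
    qed
    show ?thesis using parent_ports[unfolded if_not_P[OF down]] IH c by simp
  qed
  then show ?case
    using IH H adj_nodes'[OF adj] port_to(1)[OF adj_sym[OF adj]]
    by (simp add: current_degree_def entry_port_def)
qed

definition dart :: "algorithm \<Rightarrow> knowledge \<Rightarrow> nat \<Rightarrow> nat \<times> nat" where
  "dart A K n = map_prod id entry_port (run A K T n)"

text \<open>This links the history-based algorithm to the walk on darts. The rule
  \<open>tb K n\<close> in force may change from one move to the next.\<close>

lemma dart_Suc:
  assumes "0 < degree T (root_node T)"
  shows "dart (tour tb) K (Suc n) = next_dart T (tb K n) (dart (tour tb) K n)"
proof -
  obtain v G where run: "run (tour tb) K T n = (v, G)" by (cases "run (tour tb) K T n")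
  note inv = run_tour[OF assms run]
  have "tour tb K G = (if tb K n (depth T v) (degree T v) then entry_port G
     else (entry_port G + 1) mod degree T v)"
    using inv by (simp add: tour_def)
  then show ?thesis
    using run by (simp add: dart_def next_dart_def Let_def entry_port_def)
qed

lemma dart_0: "dart A K 0 = (root_node T, degree T (root_node T) - 1)"
  by (simp add: dart_def entry_port_def)

lemma dart_funpow:
  assumes "0 < degree T (root_node T)" "\<And>j. j < N \<Longrightarrow> tb K (n + j) = tb'" "j \<le> N"
  shows "dart (tour tb) K (n + j) = (next_dart T tb' ^^ j) (dart (tour tb) K n)"
  using assms(3)
proof (induction j)
  case (Suc j)
  then show ?case using dart_Suc[OF assms(1), of tb K "n + j"] assms(2)[of j] by simp
qed simp

text \<open>If the rule stays fixed for the length of a tour from the root, the tour is completed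
  and the agent is back in its initial dart, so that phases with different rules can follow one
  another.\<close>

lemma tour_phase:
  assumes "0 < degree T (root_node T)" "\<not> tb' 0 (degree T (root_node T))"
    and N: "N = 2 * card (explored T tb' (root_node T) - {root_node T})"
    and "\<And>j. j < N \<Longrightarrow> tb K (n + j) = tb'"
    and start: "dart (tour tb) K n = (root_node T, degree T (root_node T) - 1)"
  shows "dart (tour tb) K (n + N) = (root_node T, degree T (root_node T) - 1)"
    and "explored T tb' (root_node T) \<subseteq> visited (tour tb) K T (n + N)"
proof -
  let ?x = "(root_node T, degree T (root_node T) - 1)"
  note tr = tour_root[OF assms(1), of tb', OF assms(2), folded N, unfolded tour_reaches_def]
  have run: "dart (tour tb) K (n + j) = (next_dart T tb' ^^ j) ?x" if "j \<le> N" for j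
    using dart_funpow[OF assms(1), of N tb K n tb' j] assms(4) that start by simp
  show "dart (tour tb) K (n + N) = ?x" using run tr by simp
  show "explored T tb' (root_node T) \<subseteq> visited (tour tb) K T (n + N)"
  proof
    fix w assume "w \<in> explored T tb' (root_node T)"
    then obtain j where j: "j \<le> N" "w = fst ((next_dart T tb' ^^ j) ?x)" using tr by auto
    then have "w = fst (run (tour tb) K T (n + j))"
      using run[OF j(1)] by (metis dart_def fst_map_prod id_apply)
    then show "w \<in> visited (tour tb) K T (n + N)"
      unfolding visited_def using j(1) by (intro image_eqI) auto
  qed
qed

end

section \<open>Bounds on cost and overhead\<close>

lemma cost_le:
  assumes "level T d \<subseteq> visited A K T n"
  shows "cost A K T d \<le> of_nat n"
proof -
  have "(LEAST n. level T d \<subseteq> visited A K T n) \<le> n" using assms by (rule Least_le)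
  then show ?thesis using assms by (auto simp: cost_def)
qed

lemma finite_visited: "finite (visited A K T n)"
  by (simp add: visited_def)

lemma card_visited_minus_root: "card (visited A K T n - {root_node T}) \<le> n"
proof -
  have "root_node T \<in> visited A K T n"
    unfolding visited_def by (rule image_eqI[of _ _ 0]) auto
  moreover have "card (visited A K T n) \<le> Suc n"
    unfolding visited_def using card_image_le[of "{..n}"] by simp
  ultimately show ?thesis by simp
qed

lemma visited_mono: "n \<le> n' \<Longrightarrow> visited A K T n \<subseteq> visited A K T n'"
  unfolding visited_def by (rule image_mono) simp

text \<open>A finite bound excludes the value \<infinity> that \<open>cost\<close> takes when the
  level is never completed.\<close>

lemma level_subset_visited:
  assumes "cost A K T d \<le> ennreal x" "0 \<le> x"
  shows "level T d \<subseteq> visited A K T (nat \<lfloor>x\<rfloor>)"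
proof -
  have ex: "\<exists>n. level T d \<subseteq> visited A K T n"
    using assms by (auto simp: cost_def top_unique split: if_splits)
  let ?l = "LEAST n. level T d \<subseteq> visited A K T n"
  have "ennreal (real ?l) \<le> ennreal x"
    using assms ex by (simp add: cost_def ennreal_of_nat_eq_real_of_nat)
  then have "?l \<le> nat \<lfloor>x\<rfloor>" using assms(2) by (simp add: le_nat_floor)
  then show ?thesis using LeastI_ex[OF ex] visited_mono by blast
qed

text \<open>Whatever the agent knows, each move reaches at most one new node, and the root, visited
  for free, is not on a level \<open>d \<ge> 1\<close>.\<close>

lemma (in rooted_tree) card_level_le_cost:
  assumes "1 \<le> d"
  shows "of_nat (card (level T d)) \<le> cost A K T d"
proof (cases "\<exists>n. level T d \<subseteq> visited A K T n")
  case True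
  let ?l = "LEAST n. level T d \<subseteq> visited A K T n"
  have "level T d \<subseteq> visited A K T ?l" using LeastI_ex[OF True] .
  then have "level T d \<subseteq> visited A K T ?l - {root_node T}"
    using assms by (auto simp: level_def)
  then have "card (level T d) \<le> card (visited A K T ?l - {root_node T})"
    by (intro card_mono) (auto simp: finite_visited)
  also have "\<dots> \<le> ?l" by (rule card_visited_minus_root)
  finally show ?thesis using True by (simp add: cost_def)
qed (simp add: cost_def)

lemma divide_of_nat_le_iff_ennreal:
  assumes "0 < n"
  shows "x / of_nat n \<le> y \<longleftrightarrow> x \<le> of_nat n * (y :: ennreal)"
proof
  assume "x / of_nat n \<le> y"
  then have "of_nat n * (x / of_nat n) \<le> of_nat n * y" by (rule mult_left_mono) simp
  moreover have "of_nat n * (x / of_nat n) = x"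
    using assms by (simp add: ennreal_times_divide mult_divide_eq_ennreal mult.commute)
  ultimately show "x \<le> of_nat n * y" by simp
next
  assume "x \<le> of_nat n * y"
  then show "x / of_nat n \<le> y"
    using assms by (intro divide_le_posI_ennreal) (auto simp: mult.commute)
qed

lemma cost_le_overhead:
  assumes "(T, d) \<in> K" "1 \<le> d" "d \<le> m"
  shows "cost A K T d \<le> of_nat d * overhead A K m"
proof -
  have mem: "(T, d) \<in> restrict_dist m K" using assms by (simp add: restrict_dist_def)
  then have "cost A K T d / of_nat d \<le> (SUP (T, d) \<in> restrict_dist m K. cost A K T d / of_nat d)"
    by (intro SUP_upper2[OF mem]) simp
  also have "\<dots> = overhead A K m" using mem by (auto simp: overhead_def)
  finally show ?thesis using assms(2) by (simp add: divide_of_nat_le_iff_ennreal)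
qed

lemma overhead_leI:
  assumes "\<And>T d. (T, d) \<in> K \<Longrightarrow> d \<le> m \<Longrightarrow> 1 \<le> d \<and> cost A K T d \<le> of_nat d * M"
  shows "overhead A K m \<le> M"
proof -
  have "cost A K T d / of_nat d \<le> M" if "(T, d) \<in> restrict_dist m K" for T d
    using assms[of T d] that by (simp add: restrict_dist_def divide_of_nat_le_iff_ennreal)
  then show ?thesis unfolding overhead_def by (auto intro!: SUP_least)
qed

section \<open>Searching balls of doubling size\<close>

text \<open>Without the root, this is also the number of edges within distance \<open>r\<close>, so
  a tour down to depth \<open>r\<close> takes twice as many moves.\<close>

definition ball :: "ptree \<Rightarrow> nat \<Rightarrow> nat" where
  "ball T r = card {v \<in> nodes T. 1 \<le> depth T v \<and> depth T v \<le> r}"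

definition radius :: "ptree \<Rightarrow> nat \<Rightarrow> nat" where
  "radius T k = Max {r. r \<le> height T \<and> ball T r \<le> 2 ^ k * ball T 1}"

definition phase_start :: "ptree \<Rightarrow> nat \<Rightarrow> nat" where
  "phase_start T k = (\<Sum>j<k. 2 * ball T (radius T j))"

text \<open>The phase under way after \<open>n\<close> moves: phase \<open>k\<close> lasts from
  \<open>phase_start T k\<close> to just before \<open>phase_start T (Suc k)\<close>.\<close>

definition phase :: "ptree \<Rightarrow> nat \<Rightarrow> nat" where
  "phase T n = (LEAST k. n < phase_start T (Suc k))"

text \<open>Where this is applied, the trees in \<open>K\<close> are renumberings of one another and
  share their radii and phases, so it does not matter which one \<open>SOME\<close> selects.\<close>

definition doubling_tour :: algorithm where
  "doubling_tour = tour (\<lambda>K n k _. let S = fst (SOME x. x \<in> K) in radius S (phase S n) \<le> k)"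

context rooted_tree
begin

lemma ball_mono: "r \<le> r' \<Longrightarrow> ball T r \<le> ball T r'"
  unfolding ball_def using finite_nodes by (intro card_mono) auto

lemma ball_le_sum_levels: "ball T r \<le> (\<Sum>j=1..r. card (level T j))"
proof -
  have "{v \<in> nodes T. 1 \<le> depth T v \<and> depth T v \<le> r} = (\<Union>j\<in>{1..r}. level T j)"
    by (auto simp: level_def)
  then show ?thesis unfolding ball_def by (simp add: card_UN_le)
qed

lemma explored_ball:
  assumes "1 \<le> r"
  shows "explored T (\<lambda>k _. r \<le> k) (root_node T) - {root_node T}
     = {v \<in> nodes T. 1 \<le> depth T v \<and> depth T v \<le> r}" (is "?E - _ = ?B")
proof (intro equalityI subsetI)
  fix w assume w: "w \<in> ?E - {root_node T}"
  then have "(explore_step T (\<lambda>k _. r \<le> k))\<^sup>*\<^sup>* (root_node T) w" by (simp add: explored_def)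
  then show "w \<in> ?B"
    by cases (use w adj_nodes' in \<open>auto simp: explore_step_def\<close>)
next
  fix w assume w: "w \<in> ?B"
  then have "w \<in> ?E"
  proof (intro explored_rootI[where P = "\<lambda>w. depth T w \<le> r"], goal_cases)
    case (3 w)
    then show ?case using parent(2)[of w] by linarith
  qed auto
  then show "w \<in> ?E - {root_node T}" using w by auto
qed

end

section \<open>Phases of the doubling tour\<close>

locale nontrivial_rooted_tree = rooted_tree +
  assumes height_pos: "1 \<le> height T"
begin

lemma root_has_neighbour: "\<exists>u. adj T (root_node T) u"
proof -
  have "height T \<in> depth T ` nodes T"
    unfolding height_def using finite_nodes root_in_nodes by (intro Max_in) auto
  then obtain v where v: "v \<in> nodes T" "depth T v = height T" by auto
  then have "v \<noteq> root_node T" using height_pos by auto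
  moreover have "(adj T)\<^sup>*\<^sup>* (root_node T) v" using connected root_in_nodes v by blast
  ultimately show ?thesis by (metis converse_rtranclpE)
qed

lemma degree_root_pos: "0 < degree T (root_node T)"
  using root_has_neighbour by (auto simp: adj_def degree_def)

lemma ball_1_pos: "0 < ball T 1"
proof -
  obtain u where u: "adj T (root_node T) u" using root_has_neighbour by blast
  then have "u \<in> {v \<in> nodes T. 1 \<le> depth T v \<and> depth T v \<le> 1}"
    using child(3)[OF u] adj_nodes' by auto
  then show ?thesis
    unfolding ball_def using finite_nodes by (intro card_gt_0_iff[THEN iffD2]) auto
qed

lemma finite_radii: "finite {r. r \<le> height T \<and> ball T r \<le> 2 ^ k * ball T 1}"
  by (rule finite_subset[of _ "{..height T}"]) auto

lemma le_radius: "r \<le> height T \<Longrightarrow> ball T r \<le> 2 ^ k * ball T 1 \<Longrightarrow> r \<le> radius T k"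
  unfolding radius_def using finite_radii by (intro Max_ge) auto

lemma radius_ge_1: "1 \<le> radius T k"
  by (rule le_radius) (use height_pos in auto)

lemma ball_radius_le: "ball T (radius T k) \<le> 2 ^ k * ball T 1"
proof -
  have "1 \<in> {r. r \<le> height T \<and> ball T r \<le> 2 ^ k * ball T 1}" using height_pos by simp
  then have "radius T k \<in> {r. r \<le> height T \<and> ball T r \<le> 2 ^ k * ball T 1}"
    unfolding radius_def using finite_radii[of k] by (intro Max_in) auto
  then show ?thesis by simp
qed

text \<open>A geometric sum: phase \<open>j\<close> takes at most
  \<open>2 * 2 ^ j * ball T 1\<close> moves.\<close>

lemma phase_start_le: "phase_start T k \<le> 2 * 2 ^ k * ball T 1"
proof (induction k)
  case (Suc k)
  then show ?case using ball_radius_le[of k] by (simp add: phase_start_def)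
qed (simp add: phase_start_def)

lemma phase_eq:
  assumes "phase_start T k \<le> n" "n < phase_start T (Suc k)"
  shows "phase T n = k"
  unfolding phase_def
proof (rule Least_equality)
  fix j assume j: "n < phase_start T (Suc j)"
  show "k \<le> j"
  proof (rule ccontr)
    assume "\<not> k \<le> j"
    then have "phase_start T (Suc j) \<le> phase_start T k"
      unfolding phase_start_def by (intro sum_mono2) auto
    then show False using j assms(1) by simp
  qed
qed (rule assms(2))

end

text \<open>Depths, levels, balls, radii and phases depend only on adjacency, which renumbering
  preserves; an agent ignorant of the ports can therefore compute them from any
  representative.\<close>

lemma renumbering_facts:
  assumes "T \<in> renumberings S"
  shows "is_tree T" "adj T = adj S" "depth T = depth S" "nodes T = nodes S"
    "root_node T = root_node S" "height T = height S" "ball T = ball S" "level T = level S"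
    "radius T = radius S" "phase T = phase S"
proof -
  show T: "is_tree T" "nodes T = nodes S" "root_node T = root_node S"
    using assms by (auto simp: renumberings_def)
  show adj: "adj T = adj S" using assms by (auto simp: renumberings_def adj_def fun_eq_iff)
  show depth: "depth T = depth S" by (rule ext) (simp only: depth_def T adj)
  show height: "height T = height S" using T depth by (simp add: height_def)
  show ball: "ball T = ball S" using T depth by (simp add: ball_def fun_eq_iff)
  show "level T = level S" using T depth by (simp add: level_def fun_eq_iff)
  show radius: "radius T = radius S" using ball height by (simp add: radius_def fun_eq_iff)
  show "phase T = phase S" using ball radius by (simp add: phase_def phase_start_def fun_eq_iff)
qed

text \<open>Let \<open>k\<close> be the first phase that reaches depth \<open>d\<close> by its size
  bound. The phases up to \<open>k\<close> take at most \<open>4 * 2 ^ k * ball T 1\<close> moves,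
  and minimality of \<open>k\<close> gives \<open>2 ^ k * ball T 1 \<le> 2 * ball T d\<close>; hence
  the factor 8.\<close>

lemma (in nontrivial_rooted_tree) cost_doubling_tour:
  assumes K: "K \<noteq> {}" "\<And>x. x \<in> K \<Longrightarrow> T \<in> renumberings (fst x)" and d: "1 \<le> d" "d \<le> height T"
  shows "cost doubling_tour K T d \<le> of_nat (8 * ball T d)"
proof -
  define S where "S = fst (SOME x. x \<in> K)"
  define tb :: "knowledge \<Rightarrow> nat \<Rightarrow> nat \<Rightarrow> nat \<Rightarrow> bool" where
    "tb = (\<lambda>K n k _. let S = fst (SOME x. x \<in> K) in radius S (phase S n) \<le> k)"
  have "(SOME x. x \<in> K) \<in> K" using K(1) by (simp add: some_in_eq)
  then have "T \<in> renumberings S" using K(2) S_def by simp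
  then have tb: "tb K n = (\<lambda>k _. radius T (phase T n) \<le> k)" for n
    by (simp add: tb_def S_def[symmetric] renumbering_facts)
  have A: "doubling_tour = tour tb" by (simp add: doubling_tour_def tb_def)
  let ?tb = "\<lambda>j k _. radius T j \<le> k"
  let ?x = "(root_node T, degree T (root_node T) - 1)"
  have phase_run: "dart doubling_tour K (phase_start T (Suc j)) = ?x \<and>
      explored T (?tb j) (root_node T) \<subseteq> visited doubling_tour K T (phase_start T (Suc j))"
    if "dart doubling_tour K (phase_start T j) = ?x" for j
  proof -
    have N: "2 * ball T (radius T j) = 2 * card (explored T (?tb j) (root_node T) - {root_node T})"
      by (simp only: explored_ball[OF radius_ge_1] ball_def)
    have "\<not> radius T j \<le> 0" using radius_ge_1[of j] by simp
    moreover have "tb K (phase_start T j + i) = ?tb j" if "i < 2 * ball T (radius T j)" for i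
      using tb phase_eq[of j "phase_start T j + i"] that by (simp add: phase_start_def)
    ultimately show ?thesis
      using tour_phase[OF degree_root_pos _ N, of tb K "phase_start T j"] that
      by (simp add: A phase_start_def)
  qed
  have start: "dart doubling_tour K (phase_start T j) = ?x" for j
    by (induction j) (use phase_run in \<open>auto simp: dart_0 phase_start_def\<close>)
  have "ball T d \<le> 2 ^ ball T d" by (rule less_imp_le[OF less_exp])
  also have "\<dots> \<le> 2 ^ ball T d * ball T 1" using ball_1_pos by simp
  finally have ex: "\<exists>k. ball T d \<le> 2 ^ k * ball T 1" by blast
  define k where "k = (LEAST k. ball T d \<le> 2 ^ k * ball T 1)"
  have k: "ball T d \<le> 2 ^ k * ball T 1" unfolding k_def by (rule LeastI_ex[OF ex])
  \<comment> \<open>For \<open>k > 0\<close> the previous power of 2 was too small. For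
    \<open>k = 0\<close> the claim needs only that the ball of radius 1 lies in that of radius
    \<open>d\<close>.\<close>
  have small: "2 ^ k * ball T 1 \<le> 2 * ball T d"
  proof (cases k)
    case 0
    then show ?thesis using ball_mono[OF d(1)] by simp
  next
    case (Suc j)
    then have "\<not> ball T d \<le> 2 ^ j * ball T 1"
      using not_less_Least[of j "\<lambda>k. ball T d \<le> 2 ^ k * ball T 1"] by (simp add: k_def)
    then show ?thesis using Suc by simp
  qed
  have "d \<le> radius T k" using le_radius[OF d(2) k] .
  then have "level T d \<subseteq> {v \<in> nodes T. 1 \<le> depth T v \<and> depth T v \<le> radius T k}"
    using d(1) by (auto simp: level_def)
  also have "\<dots> \<subseteq> explored T (?tb k) (root_node T)"
    unfolding explored_ball[OF radius_ge_1, symmetric] by blast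
  finally have "level T d \<subseteq> visited doubling_tour K T (phase_start T (Suc k))"
    using phase_run[OF start] by blast
  then have "cost doubling_tour K T d \<le> of_nat (phase_start T (Suc k))" by (rule cost_le)
  also have "phase_start T (Suc k) \<le> 8 * ball T d"
    using phase_start_le[of "Suc k"] small by simp
  finally show ?thesis by simp
qed

text \<open>The common form of the three pairs: \<open>R\<close> holds the trees that the agent
  deems possible, either one tree or all renumberings of it. As every \<open>(T, j)\<close> lies in
  some \<open>K\<^sub>1 \<subseteq> K\<^sub>2\<close>, each level within reach contributes to the
  supremum.\<close>

theorem pen_bigo_linear:
  assumes "\<And>K\<^sub>2. K\<^sub>2 \<in> \<T>\<^sub>2 \<Longrightarrow> \<exists>S R. is_tree S \<and> 1 \<le> height S \<and> R \<noteq> {} \<and> R \<subseteq> renumberings S \<and>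
      K\<^sub>2 = R \<times> {1..height S} \<and>
      (\<forall>T\<in>R. \<forall>j\<in>{1..height S}. \<exists>K\<^sub>1\<in>\<T>\<^sub>1. K\<^sub>1 \<subseteq> K\<^sub>2 \<and> (T, j) \<in> K\<^sub>1)"
  shows "pen_bigo \<T>\<^sub>2 \<T>\<^sub>1 (\<lambda>m. m)"
  unfolding pen_bigo_def
proof (intro exI[of _ 8] exI[of _ doubling_tour] conjI allI impI ballI)
  show "is_algorithm doubling_tour" by (simp add: doubling_tour_def is_algorithm_tour)
next
  fix A\<^sub>1 K\<^sub>2 and m :: nat
  assume "K\<^sub>2 \<in> \<T>\<^sub>2" and m: "1 \<le> m"
  then obtain S R where S: "is_tree S" "1 \<le> height S" and R: "R \<noteq> {}" "R \<subseteq> renumberings S"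
    and K2: "K\<^sub>2 = R \<times> {1..height S}"
    and K1: "\<And>T j. T \<in> R \<Longrightarrow> j \<in> {1..height S} \<Longrightarrow> \<exists>K\<^sub>1\<in>\<T>\<^sub>1. K\<^sub>1 \<subseteq> K\<^sub>2 \<and> (T, j) \<in> K\<^sub>1"
    using assms[of K\<^sub>2] by metis
  define M where "M = (SUP K\<^sub>1\<in>{K\<^sub>1\<in>\<T>\<^sub>1. K\<^sub>1 \<subseteq> K\<^sub>2}. overhead A\<^sub>1 K\<^sub>1 m)"
  have "overhead doubling_tour K\<^sub>2 m \<le> 8 * of_nat m * M"
  proof (rule overhead_leI)
    fix T d assume Td: "(T, d) \<in> K\<^sub>2" and dm: "d \<le> m"
    then have T: "T \<in> R" "T \<in> renumberings S" and d: "1 \<le> d" "d \<le> height S"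
      using K2 R by auto
    note ren = renumbering_facts[OF T(2)]
    interpret nontrivial_rooted_tree T
      by unfold_locales (use ren S in auto)
    \<comment> \<open>Even a well-informed agent pays for each node of level \<open>j\<close>, and
      \<open>j \<le> d \<le> m\<close> places this instance within the range of the
      overhead.\<close>
    have level: "of_nat (card (level T j)) \<le> of_nat d * M" if j: "j \<in> {1..d}" for j
    proof -
      obtain K\<^sub>1 where K\<^sub>1: "K\<^sub>1 \<in> \<T>\<^sub>1" "K\<^sub>1 \<subseteq> K\<^sub>2" "(T, j) \<in> K\<^sub>1"
        using K1[OF T(1), of j] j d by auto
      have "of_nat (card (level T j)) \<le> cost A\<^sub>1 K\<^sub>1 T j" using card_level_le_cost j by simp
      also have "\<dots> \<le> of_nat j * overhead A\<^sub>1 K\<^sub>1 m"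
        using j dm by (intro cost_le_overhead K\<^sub>1) auto
      also have "\<dots> \<le> of_nat d * M"
        unfolding M_def using j K\<^sub>1 by (intro mult_mono SUP_upper) auto
      finally show ?thesis .
    qed
    have "T \<in> renumberings (fst x)" if "x \<in> K\<^sub>2" for x
      using that K2 R T(2) by (force simp: renumberings_def)
    then have "cost doubling_tour K\<^sub>2 T d \<le> of_nat (8 * ball T d)"
      using Td d ren by (intro cost_doubling_tour) auto
    also have "\<dots> \<le> of_nat (8 * (\<Sum>j=1..d. card (level T j)))"
      using ball_le_sum_levels[of d] by (intro of_nat_mono) simp
    also have "\<dots> = 8 * (\<Sum>j=1..d. of_nat (card (level T j)))" by simp
    also have "\<dots> \<le> 8 * (\<Sum>j=1..d. of_nat d * M)"
      using level by (intro mult_left_mono sum_mono) auto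
    \<comment> \<open>Of the two factors \<open>d\<close>, one is divided out by the overhead and
      the other is at most \<open>m\<close>.\<close>
    also have "\<dots> = of_nat d * (8 * of_nat d * M)" by (simp add: mult_ac)
    also have "\<dots> \<le> of_nat d * (8 * of_nat m * M)" 
      using dm by (intro mult_left_mono mult_right_mono) auto
    finally show "1 \<le> d \<and> cost doubling_tour K\<^sub>2 T d \<le> of_nat d * (8 * of_nat m * M)"
      using d by simp
  qed
  then show "overhead doubling_tour K\<^sub>2 m \<le> ennreal 8 * of_nat m *
      (SUP K\<^sub>1\<in>{K\<^sub>1\<in>\<T>\<^sub>1. K\<^sub>1 \<subseteq> K\<^sub>2}. overhead A\<^sub>1 K\<^sub>1 m)"
    by (simp add: M_def)
qed simp

section \<open>Trees given by a parent function\<close>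

text \<open>The rank drops by one at each step to the parent. This rules out cycles of parent
  pointers, and the rank becomes the depth.\<close>

locale parent_function =
  fixes V :: "nat set" and r :: nat and par :: "nat \<Rightarrow> nat" and rank :: "nat \<Rightarrow> nat"
  assumes finite_V: "finite V" and r_in_V: "r \<in> V" and rank_r: "rank r = 0"
    and par_in_V: "v \<in> V \<Longrightarrow> v \<noteq> r \<Longrightarrow> par v \<in> V"
    and rank_par: "v \<in> V \<Longrightarrow> v \<noteq> r \<Longrightarrow> rank v = Suc (rank (par v))"
begin

definition parent_tree :: ptree where
  "parent_tree = \<lparr>nodes = V, root_node = r,
     nbrs = (\<lambda>v. if v \<in> V
       then sorted_list_of_set {u \<in> V. u \<noteq> r \<and> par u = v \<or> v \<noteq> r \<and> par v = u} else [])\<rparr>"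

lemma nodes_parent_tree [simp]: "nodes parent_tree = V"
  and root_parent_tree [simp]: "root_node parent_tree = r"
  by (simp_all add: parent_tree_def)

lemma adj_parent_tree:
  "adj parent_tree u v \<longleftrightarrow> u \<in> V \<and> v \<in> V \<and> (v \<noteq> r \<and> par v = u \<or> u \<noteq> r \<and> par u = v)"
  using finite_V by (auto simp: adj_def parent_tree_def)

lemma adj_rank_cases: "adj parent_tree u v \<Longrightarrow> u \<noteq> r \<and> v = par u \<or> rank v = Suc (rank u)"
  using rank_par by (auto simp: adj_parent_tree)

text \<open>In a cycle, both neighbours of a node of maximal rank would be its parent.\<close>

lemma not_is_cycle_parent_tree: "\<not> is_cycle parent_tree xs"
proof
  assume "is_cycle parent_tree xs"
  then have xs: "3 \<le> length xs" "distinct xs" "successively (adj parent_tree) xs"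
    "adj parent_tree (last xs) (hd xs)"
    by (auto simp: is_cycle_def)
  let ?n = "length xs"
  have adj_sym: "adj parent_tree u v \<Longrightarrow> adj parent_tree v u" for u v
    by (auto simp: adj_parent_tree)
  have step: "adj parent_tree (xs ! i) (xs ! (Suc i mod ?n))" if "i < ?n" for i
  proof (cases "Suc i = ?n")
    case True
    have "xs \<noteq> []" "?n - 1 = i" using xs(1) True by auto
    then have "last xs = xs ! i" "hd xs = xs ! 0"
      by (simp_all add: last_conv_nth hd_conv_nth)
    then show ?thesis using xs(4) True by simp
  next
    case False
    then show ?thesis using xs(3) that by (simp add: successively_conv_nth)
  qed
  have fin: "finite (rank ` set xs)" "rank ` set xs \<noteq> {}" using xs(1) by auto
  obtain x where x: "x \<in> set xs" "rank x = Max (rank ` set xs)"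
    using Max_in[OF fin] by auto
  have max: "rank y \<le> rank x" if "y \<in> set xs" for y
    using fin x(2) that by simp
  obtain i where i: "i < ?n" "xs ! i = x" using x(1) by (auto simp: in_set_conv_nth)
  let ?a = "Suc i mod ?n" and ?b = "if i = 0 then ?n - 1 else i - 1"
  have a: "?a < ?n" using i(1) by (intro mod_less_divisor) linarith
  have b: "?b < ?n" "Suc ?b mod ?n = i" using i xs(1) by auto
  \<comment> \<open>Successor and predecessor of a position on the cycle differ because the cycle
    has at least three nodes.\<close>
  have ab: "?a \<noteq> ?b" using i xs(1) by (cases "Suc i = ?n") auto
  have "adj parent_tree x (xs ! ?a)" "adj parent_tree x (xs ! ?b)"
    using step[OF i(1)] step[OF b(1)] adj_sym i(2) b(2) by auto
  then have "xs ! ?a = par x" "xs ! ?b = par x"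
    using adj_rank_cases max a b(1) nth_mem by (metis Suc_n_not_le_n)+
  then show False using ab nth_eq_iff_index_eq[OF xs(2) a b(1)] by simp
qed

lemma connected_to_root: "v \<in> V \<Longrightarrow> (adj parent_tree)\<^sup>*\<^sup>* v r"
proof (induction "rank v" arbitrary: v)
  case 0
  then have "v = r" using rank_par by fastforce
  then show ?case by simp
next
  case (Suc n)
  then have "v \<noteq> r" using rank_r by auto
  then have "adj parent_tree v (par v)" "(adj parent_tree)\<^sup>*\<^sup>* (par v) r"
    using Suc rank_par par_in_V by (auto simp: adj_parent_tree)
  then show ?case by (rule converse_rtranclp_into_rtranclp)
qed

lemma is_tree_parent_tree: "is_tree parent_tree"
proof -
  have "symp (adj parent_tree)" by (auto simp: symp_def adj_parent_tree)
  then have "(adj parent_tree)\<^sup>*\<^sup>* u v" if "u \<in> V" "v \<in> V" for u v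
    using connected_to_root that by (meson rtranclp_trans sympD symp_rtranclp)
  moreover have "distinct (nbrs parent_tree v)" for v
    by (simp add: parent_tree_def)
  moreover have "set (nbrs parent_tree v) \<subseteq> V - {v}" for v
    using adj_parent_tree[of v] rank_par[of v] unfolding adj_def by auto
  moreover have "nbrs parent_tree v = []" if "v \<notin> V" for v
    using that by (simp add: parent_tree_def)
  ultimately show ?thesis
    unfolding is_tree_def
    using finite_V r_in_V not_is_cycle_parent_tree by (auto simp: adj_parent_tree)
qed

text \<open>The chain of parents is a walk of length \<open>rank v\<close>, and no walk is shorter
  because an edge raises the rank by at most one.\<close>

lemma depth_parent_tree:
  assumes "v \<in> V"
  shows "depth parent_tree v = rank v"
  unfolding depth_def
proof (rule Least_equality)
  show "(adj parent_tree ^^ rank v) (root_node parent_tree) v"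
    using assms
  proof (induction "rank v" arbitrary: v)
    case 0
    then have "v = r" using rank_par by fastforce
    then show ?case using 0 by simp
  next
    case (Suc n)
    then have "v \<noteq> r" using rank_r by auto
    then have "adj parent_tree (par v) v" "rank (par v) = n" "par v \<in> V"
      using Suc.prems Suc.hyps(2) rank_par[of v] par_in_V by (auto simp: adj_parent_tree)
    then show ?case using Suc.hyps(1)[of "par v"] Suc.hyps(2)[symmetric] by auto
  qed
next
  fix n assume "(adj parent_tree ^^ n) (root_node parent_tree) v"
  then show "rank v \<le> n"
  proof (induction n arbitrary: v)
    case 0
    then show ?case using rank_r by simp
  next
    case (Suc n)
    then obtain u where u: "(adj parent_tree ^^ n) (root_node parent_tree) u" "adj parent_tree u v"
      by auto
    have "rank v \<le> Suc (rank u)"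
      using adj_rank_cases[OF u(2)] rank_par[of u] u(2) by (auto simp: adj_parent_tree)
    then show ?case using Suc.IH[OF u(1)] by simp
  qed
qed

end

section \<open>The broom tree\<close>

text \<open>The node \<open>(i, k)\<close> is the \<open>k\<close>-th node of branch \<open>i\<close>, where \<open>1 \<le> i \<le> m\<close>: the nodes with
  \<open>k \<le> i\<close> form a path from the root, and the \<open>m * i\<close> nodes with \<open>k > i\<close> are leaves attached to
  its end \<open>(i, i)\<close>. The root is \<open>(0, 0)\<close>.\<close>

definition broom_nodes :: "nat \<Rightarrow> nat set" where
  "broom_nodes m =
     prod_encode ` insert (0, 0) {(i, k). 1 \<le> i \<and> i \<le> m \<and> 1 \<le> k \<and> k \<le> i + m * i}"

text \<open>The minimum covers both kinds of nodes: a path node is attached to its predecessor, a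
  leaf to the path end \<open>(i, i)\<close>.\<close>

definition broom_parent :: "nat \<Rightarrow> nat" where
  "broom_parent x = (case prod_decode x of (i, k) \<Rightarrow>
     if k \<le> 1 then prod_encode (0, 0) else prod_encode (i, min (k - 1) i))"

definition broom_rank :: "nat \<Rightarrow> nat" where
  "broom_rank x = (case prod_decode x of (i, k) \<Rightarrow> min k (Suc i))"

lemma broom_rank_encode [simp]: "broom_rank (prod_encode (i, k)) = min k (Suc i)"
  by (simp add: broom_rank_def)

lemma broom_parent_encode [simp]:
  "broom_parent (prod_encode (i, k)) =
     (if k \<le> 1 then prod_encode (0, 0) else prod_encode (i, min (k - 1) i))"
  by (simp add: broom_parent_def)

lemma broom_nodes_encode [simp]:
  "prod_encode (i, k) \<in> broom_nodes m \<longleftrightarrow>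
     (i, k) = (0, 0) \<or> 1 \<le> i \<and> i \<le> m \<and> 1 \<le> k \<and> k \<le> i + m * i"
  by (auto simp: broom_nodes_def)

lemma broom_nodesE:
  assumes "x \<in> broom_nodes m"
  obtains "x = prod_encode (0, 0)"
  | i k where "x = prod_encode (i, k)" "1 \<le> i" "i \<le> m" "1 \<le> k" "k \<le> i + m * i"
  using assms unfolding broom_nodes_def by auto

interpretation broom: parent_function "broom_nodes m" "prod_encode (0, 0)" broom_parent broom_rank
  for m
proof
  have "{(i, k). 1 \<le> i \<and> i \<le> m \<and> 1 \<le> k \<and> k \<le> i + m * i} \<subseteq> {..m} \<times> {..m + m * m}"
    by (auto intro: order_trans[OF _ add_mono[OF _ mult_le_mono2]])
  then show "finite (broom_nodes m)"
    unfolding broom_nodes_def by (simp add: finite_subset[OF _ finite_cartesian_product])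
next
  fix v assume "v \<in> broom_nodes m" "v \<noteq> prod_encode (0, 0)"
  then show "broom_parent v \<in> broom_nodes m" "broom_rank v = Suc (broom_rank (broom_parent v))"
    by (auto elim!: broom_nodesE simp: min_def)
qed auto

abbreviation broom_tree :: "nat \<Rightarrow> ptree" where
  "broom_tree \<equiv> broom.parent_tree"

lemma le_height_broom: "m \<le> height (broom_tree m)"
proof (cases "m = 0")
  case False
  then have v: "prod_encode (m, m) \<in> broom_nodes m" by simp
  then have "depth (broom_tree m) (prod_encode (m, m)) \<le> height (broom_tree m)"
    unfolding height_def using broom.finite_V by (intro Max_ge) auto
  then show ?thesis using broom.depth_parent_tree[OF v] by simp
qed simp

text \<open>Looking for level \<open>d\<close> in a broom tree, it is useless to visit the leaves of a branch whose
  path ends above level \<open>d - 1\<close>; such an end is recognised by its degree.\<close>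

definition broom_turn :: "nat \<Rightarrow> nat \<Rightarrow> nat \<Rightarrow> bool" where
  "broom_turn d k \<delta> \<longleftrightarrow> d \<le> k \<or> 0 < k \<and> k < d - 1 \<and> 2 < \<delta>"

definition broom_tour :: algorithm where
  "broom_tour = tour (\<lambda>K _. broom_turn (snd (SOME x. x \<in> K)))"

text \<open>Only the leaves of branch \<open>d - 1\<close> have depth \<open>d\<close>. The tour
  covers at most \<open>m * d\<close> nodes for the paths and the \<open>m * (d - 1)\<close> leaves
  of that branch, with two moves for each.\<close>

lemma cost_broom_tour:
  assumes m: "2 \<le> m" and T: "T \<in> renumberings (broom_tree m)" and d: "1 \<le> d" "d \<le> m"
    and K: "K \<noteq> {}" "\<And>x. x \<in> K \<Longrightarrow> snd x = d"
  shows "cost broom_tour K T d \<le> of_nat (4 * m * d)"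
proof -
  note ren = renumbering_facts[OF T]
  interpret nontrivial_rooted_tree T
    by unfold_locales (use ren le_height_broom[of m] m in auto)
  let ?r = "root_node T" and ?tb = "broom_turn d"
  have nodes: "nodes T = broom_nodes m" and root: "?r = prod_encode (0, 0)"
    using ren by simp_all
  have depth: "depth T v = broom_rank v" if "v \<in> broom_nodes m" for v
    using that ren broom.depth_parent_tree by simp
  have adj: "adj T u v \<longleftrightarrow> u \<in> broom_nodes m \<and> v \<in> broom_nodes m \<and>
     (v \<noteq> ?r \<and> broom_parent v = u \<or> u \<noteq> ?r \<and> broom_parent u = v)" for u v
    using ren broom.adj_parent_tree[of m] root by simp
  have par: "parent T v = broom_parent v" if "v \<in> broom_nodes m" "v \<noteq> ?r" for v
    using that broom.rank_par[of v m] broom.par_in_V[of v m] root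
    by (intro parent_eqI) (auto simp: adj depth)
  have degree: "degree T v = card {u. adj T v u}" for v
    using distinct_card[OF distinct_nbrs[of v]] by (simp add: degree_def adj_def)
  have end_degree: "2 < degree T (prod_encode (i, i))" if i: "1 \<le> i" "i \<le> m" for i
  proof -
    let ?v = "prod_encode (i, i)"
    let ?U = "{broom_parent ?v, prod_encode (i, i + 1), prod_encode (i, i + 2)}"
    \<comment> \<open>With \<open>m \<ge> 2\<close> each path end has at least two leaves besides
      its parent, so its degree differs from that of the inner path nodes.\<close>
    have "2 \<le> m * i" using m i by (metis mult_le_mono mult_1_right)
    then have "?U \<subseteq> {u. adj T ?v u}"
      using i broom.par_in_V[of ?v m] by (auto simp: adj root)
    moreover have "finite {u. adj T ?v u}"
      by (rule finite_subset[OF _ finite_nodes]) (auto dest: adj_nodes')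
    ultimately have "card ?U \<le> card {u. adj T ?v u}" by (rule card_mono[rotated])
    moreover have "card ?U = 3" using i by (auto simp: card_insert_if)
    ultimately show ?thesis using degree by simp
  qed
  have path_degree: "degree T (prod_encode (i, k)) \<le> 2" if "k < i" "1 \<le> k" for i k
  proof -
    have "{u. adj T (prod_encode (i, k)) u}
       \<subseteq> {broom_parent (prod_encode (i, k)), prod_encode (i, Suc k)}"
      using that by (auto simp: adj min_def elim!: broom_nodesE split: if_splits)
    then have "card {u. adj T (prod_encode (i, k)) u}
       \<le> card {broom_parent (prod_encode (i, k)), prod_encode (i, Suc k)}"
      by (rule card_mono[rotated]) simp
    also have "\<dots> \<le> 2" by (simp add: card_insert_if)
    finally show ?thesis using degree by simp
  qed
  have tour: "explored T ?tb ?r \<subseteq>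
      visited broom_tour K T (2 * card (explored T ?tb ?r - {?r}))"
  proof -
    have "(SOME x. x \<in> K) \<in> K" using K(1) by (simp add: some_in_eq)
    then have "snd (SOME x. x \<in> K) = d" using K(2) by blast
    moreover have "\<not> ?tb 0 (degree T ?r)" using d by (simp add: broom_turn_def)
    ultimately show ?thesis
      using tour_phase(2)[OF degree_root_pos _ refl, of ?tb
          "\<lambda>K _. broom_turn (snd (SOME x. x \<in> K))" K 0]
      by (simp add: broom_tour_def dart_0)
  qed
  have "level T d \<subseteq> explored T ?tb ?r"
  proof
    fix w assume "w \<in> level T d"
    then have w: "w \<in> nodes T" "depth T w = d" by (auto simp: level_def)
    show "w \<in> explored T ?tb ?r"
    \<comment> \<open>Branch \<open>i\<close> reaches down to depth \<open>Suc i\<close>, so the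
      invariant keeps the climb on a branch long enough for level \<open>d\<close>. Its nodes above
      depth \<open>d - 1\<close>, other than the root, are then inner path nodes of degree at most
      2, where the tour goes on.\<close>
    proof (rule explored_rootI[where
          P = "\<lambda>w. w = ?r \<or> broom_rank w \<le> d \<and> d \<le> Suc (fst (prod_decode w))"])
      show "w = ?r \<or> broom_rank w \<le> d \<and> d \<le> Suc (fst (prod_decode w))"
        using w depth nodes by (auto elim!: broom_nodesE simp: root)
    next
      fix w assume w: "w \<in> nodes T" "w \<noteq> ?r"
        and P: "w = ?r \<or> broom_rank w \<le> d \<and> d \<le> Suc (fst (prod_decode w))"
      obtain i k where ik: "w = prod_encode (i, k)" "1 \<le> i" "i \<le> m" "1 \<le> k" "k \<le> i + m * i"
        using w nodes root by (auto elim: broom_nodesE)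
      have p: "parent T w = broom_parent w" using par w nodes by simp
      show "(parent T w = ?r \<or>
           broom_rank (parent T w) \<le> d \<and> d \<le> Suc (fst (prod_decode (parent T w)))) \<and>
         \<not> ?tb (depth T (parent T w)) (degree T (parent T w))"
      proof (cases "k \<le> 1")
        case True
        then have "parent T w = ?r" using p ik root by simp
        then show ?thesis using d by (simp add: broom_turn_def)
      next
        case False
        define j where "j = min (k - 1) i"
        have pw: "parent T w = prod_encode (i, j)" using p ik(1) False by (simp add: j_def)
        have j: "1 \<le> j" "j \<le> i" using False ik by (auto simp: j_def)
        have "prod_encode (i, j) \<in> broom_nodes m" using j ik by simp
        then have dj: "depth T (parent T w) = j" using pw depth j by simp
        have jd: "Suc j \<le> d" "d \<le> Suc i" using P w ik False by (auto simp: j_def)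
        have "degree T (prod_encode (i, j)) \<le> 2" if "j < d - 1"
          by (rule path_degree) (use that jd j in linarith)+
        then have "\<not> ?tb j (degree T (prod_encode (i, j)))"
          using jd unfolding broom_turn_def by linarith
        then show ?thesis using pw dj jd j by simp
      qed
    qed (use w in simp)
  qed
  then have "cost broom_tour K T d \<le> of_nat (2 * card (explored T ?tb ?r - {?r}))"
    using tour by (intro cost_le) blast
  also have "2 * card (explored T ?tb ?r - {?r}) \<le> 4 * m * d"
  proof -
    \<comment> \<open>The second part consists of the leaves of branch \<open>d - 1\<close>, and is
      empty for \<open>d = 1\<close>. All other explored nodes have an index
      \<open>k \<le> d\<close>.\<close>
    let ?B = "prod_encode ` ({1..m} \<times> {1..d} \<union> {d - 1} \<times> {d..d - 1 + m * (d - 1)})"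
    have "explored T ?tb ?r - {?r} \<subseteq> ?B"
    proof
      fix w assume w: "w \<in> explored T ?tb ?r - {?r}"
      then have "(explore_step T ?tb)\<^sup>*\<^sup>* ?r w" by (simp add: explored_def)
      then obtain v where v: "explore_step T ?tb v w" using w by cases auto
      then have vw: "adj T v w" "depth T w = Suc (depth T v)" "\<not> ?tb (depth T v) (degree T v)"
        by (auto simp: explore_step_def)
      have wn: "w \<in> broom_nodes m" using vw(1) adj by blast
      then obtain i k where ik: "w = prod_encode (i, k)" "1 \<le> i" "i \<le> m" "1 \<le> k" "k \<le> i + m * i"
        using w root by (auto elim: broom_nodesE)
      have v: "v = broom_parent w"
        using par[OF wn] w parent_eqI[OF adj_sym[OF vw(1)]] vw(2) by simp
      have "depth T v < d" using vw(3) by (auto simp: broom_turn_def)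
      then have le: "min k (Suc i) \<le> d" using vw(2) depth[OF wn] ik(1) by simp
      show "w \<in> ?B"
      proof (cases "k \<le> d")
        case True
        then show ?thesis using ik by auto
      next
        case False
        \<comment> \<open>Now \<open>w\<close> is a leaf of branch \<open>i\<close>. The tour would
          have turned back at the end of the path unless \<open>i = d - 1\<close>.\<close>
        then have id: "Suc i \<le> d" "i < k - 1" using le by auto
        then have ve: "v = prod_encode (i, i)" using v ik False by (simp add: min_def)
        have "depth T v = i" using vw(2) depth[OF wn] ik(1) id by simp
        then have "\<not> i < d - 1"
          using vw(3) end_degree[OF ik(2,3)] ik(2) ve by (auto simp: broom_turn_def)
        then have "i = d - 1" using id by simp
        then show ?thesis using ik False by auto
      qed
    qed
    then have "card (explored T ?tb ?r - {?r}) \<le> card ?B" by (rule card_mono[rotated]) simp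
    also have "\<dots> \<le> card ({1..m} \<times> {1..d} \<union> {d - 1} \<times> {d..d - 1 + m * (d - 1)})"
      by (rule card_image_le) simp
    also have "\<dots> \<le> card ({1..m} \<times> {1..d}) + card ({d - 1} \<times> {d..d - 1 + m * (d - 1)})"
      by (rule card_Un_le)
    also have "\<dots> \<le> m * d + m * (d - 1)"
      using d by (simp add: card_cartesian_product)
    also have "\<dots> \<le> 2 * m * d" by (simp add: diff_mult_distrib2 mult.commute)
    finally show ?thesis by (simp add: mult_ac)
  qed
  finally show ?thesis by simp
qed

text \<open>Leaves of branch \<open>i\<close> have depth \<open>Suc i\<close>, so those of branches
  \<open>1, ..., m - 1\<close> lie on levels up to \<open>m\<close>. They number
  \<open>m * (1 + ... + (m - 1))\<close>; doubling avoids the division.\<close>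

lemma broom_leaves_bound:
  assumes "\<And>d. 1 \<le> d \<Longrightarrow> d \<le> m \<Longrightarrow> level (broom_tree m) d \<subseteq> visited A K (broom_tree m) N"
  shows "m * (m * (m - 1)) \<le> 2 * N"
proof -
  let ?L = "Sigma {1..<m} (\<lambda>i. {i<..i + m * i})"
  have "prod_encode ` ?L \<subseteq> visited A K (broom_tree m) N - {root_node (broom_tree m)}"
  proof
    fix x assume "x \<in> prod_encode ` ?L"
    then obtain i k where ik: "x = prod_encode (i, k)" "1 \<le> i" "i < m" "i < k" "k \<le> i + m * i"
      by auto
    then have x: "x \<in> broom_nodes m" "x \<noteq> prod_encode (0, 0)" by auto
    have "x \<in> level (broom_tree m) (Suc i)"
      using x ik broom.depth_parent_tree[OF x(1)] by (simp add: level_def)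
    then show "x \<in> visited A K (broom_tree m) N - {root_node (broom_tree m)}"
      using assms[of "Suc i"] ik x by auto
  qed
  then have "card (prod_encode ` ?L)
      \<le> card (visited A K (broom_tree m) N - {root_node (broom_tree m)})"
    by (intro card_mono) (auto simp: finite_visited)
  also have "\<dots> \<le> N" by (rule card_visited_minus_root)
  also have "card (prod_encode ` ?L) = card ?L"
    by (rule card_image) (meson inj_on_subset inj_prod_encode subset_UNIV)
  also have "card ?L = (\<Sum>i=1..<m. m * i)" by simp
  finally have "m * (\<Sum>i=1..<m. i) \<le> N" by (simp add: sum_distrib_left)
  moreover have "2 * (\<Sum>i=1..<m. i) = m * (m - 1)"
    by (induction m) (auto simp: algebra_simps)
  ultimately show ?thesis by (metis mult.left_commute mult_le_mono2)
qed

text \<open>The weaker type leaves all distances open on the broom tree, whereas each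
  \<open>K\<^sub>1\<close> fixes the distance. As \<open>broom_tour\<close> uses nothing of
  \<open>K\<^sub>1\<close> but this distance, it serves as \<open>A\<^sub>1\<close> for comp and
  blind knowledge alike.\<close>

theorem not_pen_bigo_sublinear:
  assumes T2: "\<And>S. is_tree S \<Longrightarrow> 1 \<le> height S \<Longrightarrow>
      \<exists>R. S \<in> R \<and> R \<subseteq> renumberings S \<and> R \<times> {1..height S} \<in> \<T>\<^sub>2"
    and T1: "\<And>K\<^sub>1. K\<^sub>1 \<in> \<T>\<^sub>1 \<Longrightarrow> \<exists>d. \<forall>x\<in>K\<^sub>1. snd x = d"
    and f: "(\<lambda>m. real (f m)) \<in> o(\<lambda>m. real m)"
  shows "\<not> pen_bigo \<T>\<^sub>2 \<T>\<^sub>1 f"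
proof
  assume "pen_bigo \<T>\<^sub>2 \<T>\<^sub>1 f"
  then obtain c A\<^sub>2 where c: "c > 0" and
    pen: "\<And>A\<^sub>1 K\<^sub>2 m. is_algorithm A\<^sub>1 \<Longrightarrow> K\<^sub>2 \<in> \<T>\<^sub>2 \<Longrightarrow> 1 \<le> m \<Longrightarrow> overhead A\<^sub>2 K\<^sub>2 m
      \<le> ennreal c * of_nat (f m) * (SUP K\<^sub>1\<in>{K\<^sub>1\<in>\<T>\<^sub>1. K\<^sub>1 \<subseteq> K\<^sub>2}. overhead A\<^sub>1 K\<^sub>1 m)"
    unfolding pen_bigo_def by blast
  have large: "real m - 1 \<le> 8 * c * real (f m)" if m: "2 \<le> m" for m
  proof -
    let ?S = "broom_tree m"
    have h: "m \<le> height ?S" by (rule le_height_broom)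
    then obtain R where R: "?S \<in> R" "R \<subseteq> renumberings ?S" "R \<times> {1..height ?S} \<in> \<T>\<^sub>2"
      using T2[OF broom.is_tree_parent_tree, of m] m by auto
    define K\<^sub>2 where "K\<^sub>2 = R \<times> {1..height ?S}"
    have "overhead broom_tour K\<^sub>1 m \<le> of_nat (4 * m)" if K\<^sub>1: "K\<^sub>1 \<in> \<T>\<^sub>1" "K\<^sub>1 \<subseteq> K\<^sub>2" for K\<^sub>1
    proof (rule overhead_leI)
      fix T d assume Td: "(T, d) \<in> K\<^sub>1" "d \<le> m"
      then have T: "T \<in> renumberings ?S" and d: "1 \<le> d" using K\<^sub>1 R K\<^sub>2_def by auto
      have "snd x = d" if "x \<in> K\<^sub>1" for x using T1[OF K\<^sub>1(1)] Td that by force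
      then have "cost broom_tour K\<^sub>1 T d \<le> of_nat (4 * m * d)"
        using Td by (intro cost_broom_tour[OF m T d]) auto
      then show "1 \<le> d \<and> cost broom_tour K\<^sub>1 T d \<le> of_nat d * of_nat (4 * m)"
        using d by (simp add: mult_ac)
    qed
    then have sup: "(SUP K\<^sub>1\<in>{K\<^sub>1\<in>\<T>\<^sub>1. K\<^sub>1 \<subseteq> K\<^sub>2}. overhead broom_tour K\<^sub>1 m) \<le> of_nat (4 * m)"
      by (intro SUP_least) auto
    define X where "X = c * real (f m) * real (4 * m)"
    have X: "0 \<le> X" using c by (simp add: X_def)
    have "overhead A\<^sub>2 K\<^sub>2 m \<le> ennreal c * of_nat (f m) *
        (SUP K\<^sub>1\<in>{K\<^sub>1\<in>\<T>\<^sub>1. K\<^sub>1 \<subseteq> K\<^sub>2}. overhead broom_tour K\<^sub>1 m)"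
      using R(3) m by (intro pen) (auto simp: K\<^sub>2_def broom_tour_def is_algorithm_tour)
    also have "\<dots> \<le> ennreal c * of_nat (f m) * of_nat (4 * m)"
      using sup by (rule mult_left_mono) simp
    also have "\<dots> = ennreal X"
      using c unfolding X_def ennreal_of_nat_eq_real_of_nat by (simp add: ennreal_mult)
    finally have ov: "overhead A\<^sub>2 K\<^sub>2 m \<le> ennreal X" .
    \<comment> \<open>The run depends on \<open>K\<^sub>2\<close> and the tree but not on
      \<open>d\<close>, so a single run of \<open>A\<^sub>2\<close> of this length completes all
      levels up to \<open>m\<close>.\<close>
    have "level ?S d \<subseteq> visited A\<^sub>2 K\<^sub>2 ?S (nat \<lfloor>real m * X\<rfloor>)" if d: "1 \<le> d" "d \<le> m" for d
    proof (rule level_subset_visited)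
      have "cost A\<^sub>2 K\<^sub>2 ?S d \<le> of_nat d * overhead A\<^sub>2 K\<^sub>2 m"
        using d h R(1) by (intro cost_le_overhead) (auto simp: K\<^sub>2_def)
      also have "\<dots> \<le> of_nat m * ennreal X" using d ov by (intro mult_mono) auto
      also have "\<dots> = ennreal (real m * X)"
        using X by (simp add: ennreal_of_nat_eq_real_of_nat ennreal_mult)
      finally show "cost A\<^sub>2 K\<^sub>2 ?S d \<le> ennreal (real m * X)" .
    qed (use X in simp)
    then have "m * (m * (m - 1)) \<le> 2 * nat \<lfloor>real m * X\<rfloor>" by (rule broom_leaves_bound)
    then have "real (m * (m * (m - 1))) \<le> 2 * real (nat \<lfloor>real m * X\<rfloor>)"
      by (metis of_nat_le_iff of_nat_mult of_nat_numeral)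
    also have "\<dots> \<le> 2 * (real m * X)" using X by simp
    finally have "real m * real m * (real m - 1) \<le> real m * real m * (8 * c * real (f m))"
      using m by (simp add: X_def of_nat_diff algebra_simps)
    then show ?thesis using m by (simp add: mult_le_cancel_left)
  qed
  \<comment> \<open>This constant turns \<open>large\<close> into \<open>m - 1 \<le> m / 2\<close>,
    which fails from \<open>m = 3\<close> on.\<close>
  have "eventually (\<lambda>m. norm (real (f m)) \<le> 1 / (16 * c) * norm (real m)) sequentially"
    using landau_o.smallD[OF f, of "1 / (16 * c)"] c by simp
  moreover have "eventually (\<lambda>m. 3 \<le> m) sequentially" by (rule eventually_ge_at_top)
  ultimately have "eventually (\<lambda>m. False) sequentially"
  proof eventually_elim
    case (elim m)
    then have "8 * c * real (f m) \<le> real m / 2" using c by (simp add: field_simps)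
    then show False using large[of m] elim by simp
  qed
  then show False by simp
qed

theorem theorem3p3:
  shows "\<forall>(\<T>\<^sub>2, \<T>\<^sub>1) \<in> {(comp_nodist, comp_dist), (blind_nodist, blind_dist),
                          (blind_nodist, comp_dist)}.
           pen_bigo \<T>\<^sub>2 \<T>\<^sub>1 (\<lambda>m. m) \<and>
           \<not> (\<exists>f :: nat \<Rightarrow> nat. (\<lambda>m. real (f m)) \<in> o(\<lambda>m. real m) \<and> pen_bigo \<T>\<^sub>2 \<T>\<^sub>1 f)"
proof -
  have comp_eq: "{(S, d) | d. 1 \<le> d \<and> d \<le> height S} = {S} \<times> {1..height S}" for S :: ptree
    by auto
  have blind_eq: "{(T, d) | T d. T \<in> renumberings S \<and> 1 \<le> d \<and> d \<le> height S}
      = renumberings S \<times> {1..height S}" for S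
    by auto
  \<comment> \<open>Every renumbering is itself a tree of the same height, so blind knowledge
    contains the singleton of each of its instances.\<close>
  have comp_dist_mem: "{(T, j)} \<in> comp_dist"
    if "is_tree S" "T \<in> renumberings S" "j \<in> {1..height S}" for S T j
    using that renumbering_facts[OF that(2)] by (auto simp: comp_dist_def)
  have comp_nodist_rep: "\<exists>S. is_tree S \<and> 1 \<le> height S \<and> K = {S} \<times> {1..height S}"
    if "K \<in> comp_nodist" for K
    using that unfolding comp_nodist_def comp_eq by blast
  have blind_nodist_rep: "\<exists>S. is_tree S \<and> 1 \<le> height S \<and> K = renumberings S \<times> {1..height S}"
    if "K \<in> blind_nodist" for K
    using that unfolding blind_nodist_def blind_eq by blast
  have comp_nodist_mem: "\<exists>R. S \<in> R \<and> R \<subseteq> renumberings S \<and> R \<times> {1..height S} \<in> comp_nodist"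
    if "is_tree S" "1 \<le> height S" for S
    using that renumberings_refl unfolding comp_nodist_def comp_eq
    by (intro exI[of _ "{S}"]) blast
  have blind_nodist_mem: "\<exists>R. S \<in> R \<and> R \<subseteq> renumberings S \<and> R \<times> {1..height S} \<in> blind_nodist"
    if "is_tree S" "1 \<le> height S" for S
    using that renumberings_refl unfolding blind_nodist_def blind_eq
    by (intro exI[of _ "renumberings S"]) blast
  have comp_dist_const: "\<exists>d. \<forall>x\<in>K. snd x = d" if "K \<in> comp_dist" for K
    using that by (auto simp: comp_dist_def)
  have blind_dist_const: "\<exists>d. \<forall>x\<in>K. snd x = d" if "K \<in> blind_dist" for K
    using that by (auto simp: blind_dist_def)
  have "pen_bigo comp_nodist comp_dist (\<lambda>m. m)"
  proof (rule pen_bigo_linear)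
    fix K assume "K \<in> comp_nodist"
    then obtain S where S: "is_tree S" "1 \<le> height S" "K = {S} \<times> {1..height S}"
      using comp_nodist_rep by blast
    have "\<exists>K\<^sub>1\<in>comp_dist. K\<^sub>1 \<subseteq> K \<and> (T, j) \<in> K\<^sub>1" if "T \<in> {S}" "j \<in> {1..height S}" for T j
      using comp_dist_mem[OF S(1), of T j] renumberings_refl[OF S(1)] S(3) that
      by (intro bexI[of _ "{(T, j)}"]) auto
    then show "\<exists>S R. is_tree S \<and> 1 \<le> height S \<and> R \<noteq> {} \<and> R \<subseteq> renumberings S \<and>
      K = R \<times> {1..height S} \<and>
      (\<forall>T\<in>R. \<forall>j\<in>{1..height S}. \<exists>K\<^sub>1\<in>comp_dist. K\<^sub>1 \<subseteq> K \<and> (T, j) \<in> K\<^sub>1)"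
      using S renumberings_refl[OF S(1)] by (intro exI[of _ S] exI[of _ "{S}"]) auto
  qed
  \<comment> \<open>Kept general in \<open>\<T>\<^sub>1\<close> to serve both pairs with
    \<open>blind_nodist\<close>.\<close>
  moreover have "pen_bigo blind_nodist \<T>\<^sub>1 (\<lambda>m. m)"
    if "\<And>S T j. is_tree S \<Longrightarrow> T \<in> renumberings S \<Longrightarrow> j \<in> {1..height S} \<Longrightarrow>
      \<exists>K\<^sub>1\<in>\<T>\<^sub>1. K\<^sub>1 \<subseteq> renumberings S \<times> {1..height S} \<and> (T, j) \<in> K\<^sub>1" for \<T>\<^sub>1
  proof (rule pen_bigo_linear)
    fix K assume "K \<in> blind_nodist"
    then obtain S where S: "is_tree S" "1 \<le> height S" "K = renumberings S \<times> {1..height S}"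
      using blind_nodist_rep by blast
    then show "\<exists>S R. is_tree S \<and> 1 \<le> height S \<and> R \<noteq> {} \<and> R \<subseteq> renumberings S \<and>
      K = R \<times> {1..height S} \<and>
      (\<forall>T\<in>R. \<forall>j\<in>{1..height S}. \<exists>K\<^sub>1\<in>\<T>\<^sub>1. K\<^sub>1 \<subseteq> K \<and> (T, j) \<in> K\<^sub>1)"
      using that[OF S(1)] renumberings_refl[OF S(1)]
      by (intro exI[of _ S] exI[of _ "renumberings S"]) auto
  qed
  moreover have "\<exists>K\<^sub>1\<in>comp_dist. K\<^sub>1 \<subseteq> renumberings S \<times> {1..height S} \<and> (T, j) \<in> K\<^sub>1"
    if "is_tree S" "T \<in> renumberings S" "j \<in> {1..height S}" for S T j
    using comp_dist_mem[OF that] that by (intro bexI[of _ "{(T, j)}"]) auto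
  moreover have "\<exists>K\<^sub>1\<in>blind_dist. K\<^sub>1 \<subseteq> renumberings S \<times> {1..height S} \<and> (T, j) \<in> K\<^sub>1"
    if "is_tree S" "T \<in> renumberings S" "j \<in> {1..height S}" for S T j
  proof (rule bexI[of _ "{(T, j) | T. T \<in> renumberings S}"])
    show "{(T, j) | T. T \<in> renumberings S} \<in> blind_dist"
      unfolding blind_dist_def using that by auto
  qed (use that in auto)
  ultimately show ?thesis
    using not_pen_bigo_sublinear[OF comp_nodist_mem comp_dist_const]
      not_pen_bigo_sublinear[OF blind_nodist_mem comp_dist_const]
      not_pen_bigo_sublinear[OF blind_nodist_mem blind_dist_const]
    by auto
qed

end
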